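(* The ring $\mathfrak{J}^{(1)}$ is generated as a $\mathbb{C}$-algebra by (bases of) $\mathfrak{J}^{(1)}_8$ and $\mathfrak{J}^{(1)}_{24}$; that is, $\mathfrak{J}^{(1)}=\mathbb{C}[\mathfrak{J}^{(1)}_8\cup\mathfrak{J}^{(1)}_{24}]$.
   Context: A binary linear code $C\subseteq\mathbb{F}_2^n$ is Type II if $C=C^\perp$ (with respect to the standard inner product) and all codeword weights are divisible by $4$. For $T\subseteq[n]=\{1,\dots,n\}$, the genus-$1$ Jacobi polynomial of $C$ is $J^{(1)}_{C,T}=\sum_{u\in C}y_0^{m_0(u)}y_1^{m_1(u)}x_0^{n_0(u)}x_1^{n_1(u)}$, where $m_a(u)$ (resp. $n_a(u)$) is the number of coordinates $i\in T$ (resp. $i\in[n]\setminus T$) with $u_i=a$. $\mathfrak{J}^{(1)}$ is the $\mathbb{C}$-algebra generated by all $J^{(1)}_{C,T}$ with $C$ a Type II code of any length and $T$ any subset of its coordinates, and $\mathfrak{J}^{(1)}_n$ denotes its homogeneous part of degree $n$. *)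

theory Defs
  imports
    "HOL-Library.Z2"
    "HOL-Library.Poly_Mapping"
    "Jordan_Normal_Form.VS_Connect"
begin

text \<open>
  The field of two elements is \<^typ>\<open>bit\<close>. Words of length \<open>n\<close> are elements of
  \<^term>\<open>carrier_vec n :: bit vec set\<close>, so the coordinates are numbered \<open>0, \<dots>, n - 1\<close>.
\<close>

definition linear_code :: "nat \<Rightarrow> bit vec set \<Rightarrow> bool" where
  "linear_code n C \<longleftrightarrow> VectorSpace.subspace class_ring C (module_vec TYPE(bit) n)"

definition dual_code :: "nat \<Rightarrow> bit vec set \<Rightarrow> bit vec set" where
  "dual_code n C = {v \<in> carrier_vec n. \<forall>u\<in>C. u \<bullet> v = 0}"

definition weight :: "bit vec \<Rightarrow> nat" where
  "weight u = card {i. i < dim_vec u \<and> u $ i \<noteq> 0}"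

definition type_II :: "nat \<Rightarrow> bit vec set \<Rightarrow> bool" where
  "type_II n C \<longleftrightarrow> linear_code n C \<and> C = dual_code n C \<and> (\<forall>u\<in>C. 4 dvd weight u)"

text \<open>
  The polynomial ring in the four variables \<open>y\<^sub>0, y\<^sub>1, x\<^sub>0, x\<^sub>1\<close>: finitely supported functions
  from exponent vectors to complex coefficients, with the convolution product.
\<close>

datatype jvar = Y bit | X bit

type_synonym jpoly = "(jvar \<Rightarrow>\<^sub>0 nat) \<Rightarrow>\<^sub>0 complex"

definition var :: "jvar \<Rightarrow> jpoly" where
  "var v = Poly_Mapping.single (Poly_Mapping.single v 1) 1"

definition const :: "complex \<Rightarrow> jpoly" where
  "const c = Poly_Mapping.single 0 c"

definition homogeneous :: "nat \<Rightarrow> jpoly \<Rightarrow> bool" where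
  "homogeneous d p \<longleftrightarrow>
     (\<forall>m \<in> Poly_Mapping.keys p. (\<Sum>v \<in> Poly_Mapping.keys m. Poly_Mapping.lookup m v) = d)"

definition coord_count :: "nat set \<Rightarrow> bit \<Rightarrow> bit vec \<Rightarrow> nat" where
  "coord_count S a u = card {i \<in> S. u $ i = a}"

definition jacobi_poly :: "nat \<Rightarrow> bit vec set \<Rightarrow> nat set \<Rightarrow> jpoly" where
  "jacobi_poly n C T =
     (\<Sum>u\<in>C. var (Y 0) ^ coord_count T 0 u * var (Y 1) ^ coord_count T 1 u *
            var (X 0) ^ coord_count ({..<n} - T) 0 u * var (X 1) ^ coord_count ({..<n} - T) 1 u)"

inductive_set alg_generated :: "jpoly set \<Rightarrow> jpoly set" for S :: "jpoly set" where
  gen: "p \<in> S \<Longrightarrow> p \<in> alg_generated S"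
| const: "const c \<in> alg_generated S"
| add: "p \<in> alg_generated S \<Longrightarrow> q \<in> alg_generated S \<Longrightarrow> p + q \<in> alg_generated S"
| mult: "p \<in> alg_generated S \<Longrightarrow> q \<in> alg_generated S \<Longrightarrow> p * q \<in> alg_generated S"

definition jacobi_ring :: "jpoly set" where
  "jacobi_ring = alg_generated {jacobi_poly n C T | n C T. type_II n C \<and> T \<subseteq> {..<n}}"

definition jacobi_part :: "nat \<Rightarrow> jpoly set" where
  "jacobi_part d = {p \<in> jacobi_ring. homogeneous d p}"

definition poly_scale :: "complex \<Rightarrow> jpoly \<Rightarrow> jpoly" where
  "poly_scale c p = const c * p"

lemma vector_space_poly_scale: "vector_space poly_scale"
  by unfold_locales
    (simp_all add: poly_scale_def const_def ring_distribs single_add mult_single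
      mult.assoc [symmetric])

definition is_basis :: "jpoly set \<Rightarrow> jpoly set \<Rightarrow> bool" where
  "is_basis B V \<longleftrightarrow> \<not> Modules.module.dependent poly_scale B \<and> Modules.module.span poly_scale B = V"

end

theory Submission
  imports Defs
begin

text \<open>
  Every Jacobi polynomial of a Type II code is invariant under the group \<open>G\<close> generated by the
  MacWilliams matrix and \<open>diag(1, \<i>)\<close>, which acts simultaneously on the pairs \<open>(x\<^sub>0, x\<^sub>1)\<close> and
  \<open>(y\<^sub>0, y\<^sub>1)\<close>. Let \<open>A\<close> be the algebra generated by the Jacobi polynomials of length 8 and 24. It is
  stable under the polarization \<open>E = y\<^sub>0 \<partial>/\<partial>x\<^sub>0 + y\<^sub>1 \<partial>/\<partial>x\<^sub>1\<close>, because \<open>E J\<^bsub>C,T\<^esub>\<close> is the sum of the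
  \<open>J\<^bsub>C,T\<union>{i}\<^esub>\<close> with \<open>i \<notin> T\<close>. With \<open>D = x\<^sub>0 y\<^sub>1 - x\<^sub>1 y\<^sub>0\<close>, the adjoint polarization \<open>F\<close> and Cayley's operator
  \<open>\<Omega>\<close>, Capelli's identity \<open>(k + 1) j q = D (\<Omega> q) + E (F q)\<close> for \<open>q\<close> of bidegree \<open>(j, k)\<close> in \<open>(y, x)\<close>
  reduces, by induction on \<open>j\<close>, the claim that all invariants \<open>D\<^sup>b q\<close> lie in \<open>A\<close> to binary forms \<open>q\<close> in
  \<open>x\<^sub>0, x\<^sub>1\<close> which are semi-invariant for the character \<open>det\<^sup>-\<^sup>b\<close>. These are \<open>1\<close>, \<open>f\<^sup>3 h\<close>, \<open>f\<^sup>2\<close>, \<open>f h\<close>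
  (for \<open>b = 0, 1, 2, 3\<close> modulo 4) times polynomials in \<open>W\<close> and \<open>f\<^sup>4\<close>, where \<open>W\<close> is the weight enumerator
  of the extended Hamming code and \<open>f\<close>, \<open>h\<close> are the semi-invariants of degree 6 and 12. Finally \<open>W\<close>, \<open>f\<^sup>4\<close>
  and \<open>D\<^sup>4\<close> are obtained from the codes \<open>d\<^sub>8\<^sup>+\<close> and \<open>d\<^sub>2\<^sub>4\<^sup>+\<close>, while \<open>D\<^sup>2 f\<^sup>2\<close>, \<open>D\<^sup>3 f h\<close> and \<open>D f\<^sup>3 h\<close> are
  transvectants of these.
\<close>

section \<open>Substitution and derivations\<close>

interpretation const_hom: comm_ring_hom const
  by unfold_locales (simp_all add: const_def single_add mult_single)

lemma UNIV_jvar: "(UNIV :: jvar set) = {Y 0, Y 1, X 0, X 1}"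
proof -
  have "v \<in> {Y 0, Y 1, X 0, X 1}" for v :: jvar
  proof (cases v)
    case (Y b) then show ?thesis by (cases b) simp_all
  next
    case (X b) then show ?thesis by (cases b) simp_all
  qed
  then show ?thesis by blast
qed

lemma all_jvar: "(\<forall>v. P v) \<longleftrightarrow> P (Y 0) \<and> P (Y 1) \<and> P (X 0) \<and> P (X 1)"
proof -
  have "(\<forall>v. P v) \<longleftrightarrow> (\<forall>v\<in>UNIV. P v)" by simp
  then show ?thesis by (simp only: UNIV_jvar) simp
qed

section \<open>Evaluation of polynomials at a family of ring elements\<close>

definition monom_at :: "(jvar \<Rightarrow> 'a::comm_ring_1) \<Rightarrow> (jvar \<Rightarrow>\<^sub>0 nat) \<Rightarrow> 'a" where
  "monom_at \<sigma> m = \<sigma> (Y 0) ^ Poly_Mapping.lookup m (Y 0) * \<sigma> (Y 1) ^ Poly_Mapping.lookup m (Y 1) *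
     (\<sigma> (X 0) ^ Poly_Mapping.lookup m (X 0) * \<sigma> (X 1) ^ Poly_Mapping.lookup m (X 1))"

lemma monom_at_0: "monom_at \<sigma> 0 = 1"
  by (simp add: monom_at_def)

lemma monom_at_add: "monom_at \<sigma> (m + n) = monom_at \<sigma> m * monom_at \<sigma> n"
  by (simp add: monom_at_def lookup_add power_add algebra_simps)

lemma var_power: "var v ^ n = Poly_Mapping.single (Poly_Mapping.single v n) 1"
  by (induction n) (simp_all add: var_def mult_single single_add [symmetric])

lemma single_eq_monom_at: "Poly_Mapping.single m c = const c * monom_at var m"
proof -
  have m: "m = Poly_Mapping.single (Y 0) (Poly_Mapping.lookup m (Y 0)) + Poly_Mapping.single (Y 1) (Poly_Mapping.lookup m (Y 1))
      + (Poly_Mapping.single (X 0) (Poly_Mapping.lookup m (X 0)) + Poly_Mapping.single (X 1) (Poly_Mapping.lookup m (X 1)))"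
    (is "_ = ?m")
  proof (rule poly_mapping_eqI)
    have "\<forall>v. Poly_Mapping.lookup m v = Poly_Mapping.lookup ?m v"
      by (simp add: all_jvar lookup_add lookup_single when_def)
    then show "Poly_Mapping.lookup m v = Poly_Mapping.lookup ?m v" for v by blast
  qed
  have "const c * monom_at var m = Poly_Mapping.single ?m c"
    by (simp add: const_def monom_at_def var_power mult_single)
  then show ?thesis using m by simp
qed

lemma jpoly_decomp: "p = (\<Sum>m\<in>Poly_Mapping.keys p. const (Poly_Mapping.lookup p m) * monom_at var m)" for p :: jpoly
proof (rule poly_mapping_eqI)
  fix k
  have "Poly_Mapping.lookup (\<Sum>m\<in>Poly_Mapping.keys p. Poly_Mapping.single m (Poly_Mapping.lookup p m)) k = Poly_Mapping.lookup p k"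
  proof -
    have "(\<Sum>m\<in>Poly_Mapping.keys p. Poly_Mapping.lookup p m when m = k) = (\<Sum>m\<in>Poly_Mapping.keys p. if m = k then Poly_Mapping.lookup p m else 0)"
      by (intro sum.cong) (auto simp: when_def)
    also have "\<dots> = Poly_Mapping.lookup p k"
      by (simp add: sum.delta in_keys_iff)
    finally show ?thesis by (simp add: lookup_sum lookup_single)
  qed
  then show "Poly_Mapping.lookup p k = Poly_Mapping.lookup (\<Sum>m\<in>Poly_Mapping.keys p. const (Poly_Mapping.lookup p m) * monom_at var m) k"
    by (simp add: single_eq_monom_at)
qed

text \<open>Identities between homomorphisms or derivations need checking only on constants and
  variables; most structural facts about \<open>psubst\<close> and \<open>derivation\<close> below
  are obtained this way.\<close>

lemma jpoly_induct [case_names const var add mult]: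
  assumes "\<And>c. P (const c)" "\<And>v. P (var v)"
    and add: "\<And>p q. P p \<Longrightarrow> P q \<Longrightarrow> P (p + q)"
    and mult: "\<And>p q. P p \<Longrightarrow> P q \<Longrightarrow> P (p * q)"
  shows "P p"
proof -
  have one: "P 1" using assms(1) [of 1] by simp
  have zero: "P 0" using assms(1) [of 0] by simp
  have pow: "P (var v ^ n)" for v n
    by (induction n) (simp_all add: one assms(2) mult)
  have sum: "P (sum f M)" if "\<And>m. m \<in> M \<Longrightarrow> P (f m)" "finite M" for M and f :: "_ \<Rightarrow> jpoly"
    using that(2,1) by (induction M) (simp_all add: zero add)
  have "P (\<Sum>m\<in>Poly_Mapping.keys p. const (Poly_Mapping.lookup p m) * monom_at var m)"
    unfolding monom_at_def by (intro sum mult pow assms(1)) simp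
  then show ?thesis using jpoly_decomp [of p] by simp
qed

text \<open>The target ring is left open because four are used: \<open>jpoly\<close> for
  substitutions, polynomials over \<open>jpoly\<close> for dual numbers, complex polynomials for
  dehomogenization, and the complex numbers for evaluation at ones.\<close>

definition psubst :: "(complex \<Rightarrow> 'a::comm_ring_1) \<Rightarrow> (jvar \<Rightarrow> 'a) \<Rightarrow> jpoly \<Rightarrow> 'a" where
  "psubst \<iota> \<sigma> p = (\<Sum>m\<in>Poly_Mapping.keys p. \<iota> (Poly_Mapping.lookup p m) * monom_at \<sigma> m)"

context
  fixes \<iota> :: "complex \<Rightarrow> 'a::comm_ring_1"
  assumes \<iota>: "comm_ring_hom \<iota>"
begin

interpretation \<iota>: comm_ring_hom \<iota> by (rule \<iota>)

lemma psubst_superset: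
  assumes "finite K" "Poly_Mapping.keys p \<subseteq> K"
  shows "psubst \<iota> \<sigma> p = (\<Sum>m\<in>K. \<iota> (Poly_Mapping.lookup p m) * monom_at \<sigma> m)"
  unfolding psubst_def using assms
  by (intro sum.mono_neutral_left) (auto simp: in_keys_iff)

lemma psubst_single: "psubst \<iota> \<sigma> (Poly_Mapping.single m c) = \<iota> c * monom_at \<sigma> m"
  by (subst psubst_superset [of "{m}"]) (auto split: if_splits)

lemma psubst_const: "psubst \<iota> \<sigma> (const c) = \<iota> c"
  by (simp add: const_def psubst_single monom_at_0)

lemma psubst_var: "psubst \<iota> \<sigma> (var v) = \<sigma> v"
proof -
  have "\<forall>v. monom_at \<sigma> (Poly_Mapping.single v 1) = \<sigma> v"
    by (simp add: all_jvar monom_at_def lookup_single when_def)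
  then show ?thesis by (simp add: var_def psubst_single)
qed

lemma psubst_add: "psubst \<iota> \<sigma> (p + q) = psubst \<iota> \<sigma> p + psubst \<iota> \<sigma> q"
proof -
  let ?K = "Poly_Mapping.keys p \<union> Poly_Mapping.keys q"
  have "psubst \<iota> \<sigma> (p + q) = (\<Sum>m\<in>?K. \<iota> (Poly_Mapping.lookup (p + q) m) * monom_at \<sigma> m)"
    by (intro psubst_superset) (simp_all add: keys_add)
  also have "\<dots> = (\<Sum>m\<in>?K. \<iota> (Poly_Mapping.lookup p m) * monom_at \<sigma> m) + (\<Sum>m\<in>?K. \<iota> (Poly_Mapping.lookup q m) * monom_at \<sigma> m)"
    by (simp add: lookup_add \<iota>.hom_add distrib_right sum.distrib)
  also have "\<dots> = psubst \<iota> \<sigma> p + psubst \<iota> \<sigma> q"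
    by (simp add: psubst_superset [of ?K])
  finally show ?thesis .
qed

lemma psubst_sum: "finite A \<Longrightarrow> psubst \<iota> \<sigma> (sum f A) = (\<Sum>a\<in>A. psubst \<iota> \<sigma> (f a))"
proof (induction A rule: finite_induct)
  case empty
  show ?case by (simp add: psubst_def)
qed (simp add: psubst_add)

lemma psubst_mult: "psubst \<iota> \<sigma> (p * q) = psubst \<iota> \<sigma> p * psubst \<iota> \<sigma> q"
proof -
  have "p * q = (\<Sum>m\<in>Poly_Mapping.keys p. Poly_Mapping.single m (Poly_Mapping.lookup p m)) *
      (\<Sum>n\<in>Poly_Mapping.keys q. Poly_Mapping.single n (Poly_Mapping.lookup q n))"
    using jpoly_decomp [of p] jpoly_decomp [of q] by (simp add: single_eq_monom_at)
  also have "\<dots> = (\<Sum>m\<in>Poly_Mapping.keys p. \<Sum>n\<in>Poly_Mapping.keys q. Poly_Mapping.single (m + n) (Poly_Mapping.lookup p m * Poly_Mapping.lookup q n))"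
    by (simp add: sum_product mult_single)
  also have "psubst \<iota> \<sigma> \<dots> = (\<Sum>m\<in>Poly_Mapping.keys p. \<Sum>n\<in>Poly_Mapping.keys q.
      \<iota> (Poly_Mapping.lookup p m) * monom_at \<sigma> m * (\<iota> (Poly_Mapping.lookup q n) * monom_at \<sigma> n))"
    by (simp add: psubst_sum psubst_single \<iota>.hom_mult monom_at_add algebra_simps)
  also have "\<dots> = psubst \<iota> \<sigma> p * psubst \<iota> \<sigma> q"
    by (simp add: psubst_def sum_product)
  finally show ?thesis .
qed

lemma psubst_hom: "comm_ring_hom (psubst \<iota> \<sigma>)"
proof
  show "psubst \<iota> \<sigma> 0 = 0" by (simp add: psubst_def)
  show "psubst \<iota> \<sigma> 1 = 1" using psubst_const [of \<sigma> 1] by simp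
qed (simp_all add: psubst_add psubst_mult)

end

text \<open>The derivation is the coefficient of the infinitesimal in the dual numbers over
  \<^typ>\<open>jpoly\<close>, which are obtained here as polynomials modulo second order terms.\<close>

definition derivation :: "(jvar \<Rightarrow> jpoly) \<Rightarrow> jpoly \<Rightarrow> jpoly" where
  "derivation \<delta> p = coeff (psubst (\<lambda>c. [:const c:]) (\<lambda>v. [:var v, \<delta> v:]) p) 1"

lemma const_poly_hom: "comm_ring_hom (\<lambda>c. [:const c:])"
  by unfold_locales (simp_all add: const_hom.hom_add const_hom.hom_mult one_pCons)

context
  fixes \<delta> :: "jvar \<Rightarrow> jpoly"
begin

text \<open>Killing the infinitesimal recovers \<open>p\<close>; hence the degree 1 coefficient of a
  product obeys the Leibniz rule.\<close>

private lemma dual_coeff_0: "coeff (psubst (\<lambda>c. [:const c:]) (\<lambda>v. [:var v, \<delta> v:]) p) 0 = p"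
  by (induction p rule: jpoly_induct)
    (simp_all add: psubst_const [OF const_poly_hom] psubst_var [OF const_poly_hom]
      psubst_add [OF const_poly_hom] psubst_mult [OF const_poly_hom] coeff_mult_0)

lemma derivation_const [simp]: "derivation \<delta> (const c) = 0"
  by (simp add: derivation_def psubst_const [OF const_poly_hom])

lemma derivation_var [simp]: "derivation \<delta> (var v) = \<delta> v"
  by (simp add: derivation_def psubst_var [OF const_poly_hom])

lemma derivation_add [simp]: "derivation \<delta> (p + q) = derivation \<delta> p + derivation \<delta> q"
  by (simp add: derivation_def psubst_add [OF const_poly_hom])

lemma derivation_mult [simp]: "derivation \<delta> (p * q) = derivation \<delta> p * q + p * derivation \<delta> q"
proof -
  have "coeff (P * Q) 1 = coeff P 1 * coeff Q 0 + coeff P 0 * coeff Q 1" for P Q :: "jpoly poly"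
    by (simp add: coeff_mult)
  then show ?thesis
    by (simp add: derivation_def psubst_mult [OF const_poly_hom] dual_coeff_0 del: One_nat_def)
qed

lemma derivation_0 [simp]: "derivation \<delta> 0 = 0"
  using derivation_const [of 0] by simp

lemma derivation_1 [simp]: "derivation \<delta> 1 = 0"
  using derivation_const [of 1] by simp

lemma derivation_numeral [simp]: "derivation \<delta> (numeral k) = 0"
  using derivation_const [of "numeral k"] by (simp add: const_hom.hom_numeral)

lemma derivation_uminus [simp]: "derivation \<delta> (- p) = - derivation \<delta> p"
  using derivation_add [of p "- p"] by (simp add: eq_neg_iff_add_eq_0 add.commute)

lemma derivation_diff [simp]: "derivation \<delta> (p - q) = derivation \<delta> p - derivation \<delta> q"
  using derivation_add [of p "- q"] by simp

lemma derivation_sum: "derivation \<delta> (sum f A) = (\<Sum>a\<in>A. derivation \<delta> (f a))"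
  by (induction A rule: infinite_finite_induct) simp_all

lemma derivation_power: "derivation \<delta> (p ^ n) = of_nat n * p ^ (n - 1) * derivation \<delta> p"
proof (induction n)
  case (Suc n)
  then show ?case by (cases n) (simp_all add: algebra_simps)
qed simp

lemma derivation_prod:
  "finite A \<Longrightarrow> derivation \<delta> (prod f A) = (\<Sum>a\<in>A. derivation \<delta> (f a) * prod f (A - {a}))"
proof (induction A rule: finite_induct)
  case (insert x A)
  have "prod f (insert x A - {a}) = f x * prod f (A - {a})" if "a \<in> A" for a
  proof -
    have "insert x A - {a} = insert x (A - {a})" using insert that by auto
    then show ?thesis using insert by simp
  qed
  then have "(\<Sum>a\<in>A. derivation \<delta> (f a) * prod f (insert x A - {a})) =
      f x * (\<Sum>a\<in>A. derivation \<delta> (f a) * prod f (A - {a}))"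
    unfolding sum_distrib_left by (intro sum.cong) (simp_all add: mult.left_commute)
  moreover have "insert x A - {x} = A" using insert by auto
  ultimately show ?case using insert by simp
qed simp

end

section \<open>Semi-invariant binary forms\<close>

text \<open>A binary form of degree \<open>k\<close> is represented by its dehomogenization \<open>Q\<close> at \<open>x\<^sub>0 = 1\<close>, so \<open>k\<close> may
  exceed the degree of \<open>Q\<close>; \<open>bform \<iota> k Q a b\<close> is the value of the form at \<open>(a, b)\<close>.\<close>

definition bform :: "(complex \<Rightarrow> 'a::comm_ring_1) \<Rightarrow> nat \<Rightarrow> complex poly \<Rightarrow> 'a \<Rightarrow> 'a \<Rightarrow> 'a" where
  "bform \<iota> k Q a b = (\<Sum>i\<le>k. \<iota> (coeff Q i) * a ^ (k - i) * b ^ i)"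

lemma bform_pCons: "bform \<iota> (Suc k) (pCons c Q) a b = \<iota> c * a ^ Suc k + b * bform \<iota> k Q a b"
  unfolding bform_def by (subst sum.atMost_Suc_shift) (simp add: sum_distrib_left algebra_simps)

lemma bform_0: "bform \<iota> 0 Q a b = \<iota> (coeff Q 0)"
  by (simp add: bform_def)

lemma bform_hom_apply:
  assumes "comm_ring_hom h"
  shows "h (bform \<iota> k Q a b) = bform (\<lambda>c. h (\<iota> c)) k Q (h a) (h b)"
proof -
  interpret h: comm_ring_hom h by fact
  show ?thesis by (simp add: bform_def h.hom_sum h.hom_mult h.hom_power)
qed

lemma bform_scale: "bform \<iota> k Q (c * a) (c * b) = c ^ k * bform \<iota> k Q a b"
proof -
  have "\<iota> (coeff Q i) * (c * a) ^ (k - i) * (c * b) ^ i =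
      c ^ k * (\<iota> (coeff Q i) * a ^ (k - i) * b ^ i)" if "i \<le> k" for i
  proof -
    have "c ^ k = c ^ (k - i) * c ^ i" using that by (simp flip: power_add)
    then show ?thesis by (simp add: power_mult_distrib mult_ac)
  qed
  then show ?thesis by (simp add: bform_def sum_distrib_left)
qed

context
  fixes \<iota> :: "complex \<Rightarrow> 'a::comm_ring_1"
  assumes \<iota>: "comm_ring_hom \<iota>"
begin

interpretation \<iota>: comm_ring_hom \<iota> by (rule \<iota>)

lemma bform_zero_poly: "bform \<iota> k 0 a b = 0"
  by (simp add: bform_def)

lemma bform_add: "bform \<iota> k (P + Q) a b = bform \<iota> k P a b + bform \<iota> k Q a b"
  by (simp add: bform_def \<iota>.hom_add distrib_right sum.distrib)

lemma bform_smult: "bform \<iota> k (Polynomial.smult c Q) a b = \<iota> c * bform \<iota> k Q a b"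
  by (simp add: bform_def \<iota>.hom_mult sum_distrib_left mult.assoc)

text \<open>A larger nominal degree means an extra power of the first variable, which
  dehomogenization cannot see.\<close>

lemma bform_raise:
  assumes "degree Q \<le> k"
  shows "bform \<iota> (m + k) Q a b = a ^ m * bform \<iota> k Q a b"
proof -
  have "bform \<iota> (m + k) Q a b = (\<Sum>i\<le>k. \<iota> (coeff Q i) * a ^ (m + k - i) * b ^ i)"
    unfolding bform_def using assms
    by (intro sum.mono_neutral_right) (auto simp: coeff_eq_0)
  also have "\<dots> = (\<Sum>i\<le>k. a ^ m * (\<iota> (coeff Q i) * a ^ (k - i) * b ^ i))"
  proof (intro sum.cong refl)
    fix i assume "i \<in> {..k}"
    then have "a ^ (m + k - i) = a ^ m * a ^ (k - i)" by (simp flip: power_add)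
    then show "\<iota> (coeff Q i) * a ^ (m + k - i) * b ^ i = a ^ m * (\<iota> (coeff Q i) * a ^ (k - i) * b ^ i)"
      by (simp add: mult_ac)
  qed
  also have "\<dots> = a ^ m * bform \<iota> k Q a b"
    by (simp add: bform_def sum_distrib_left)
  finally show ?thesis .
qed

text \<open>Induction on the nominal degree of \<open>P\<close>, splitting off its constant
  coefficient: that part multiplies a form of raised degree, the rest carries a factor
  \<open>b\<close>.\<close>

lemma bform_mult:
  assumes "degree P \<le> m" "degree Q \<le> n"
  shows "bform \<iota> (m + n) (P * Q) a b = bform \<iota> m P a b * bform \<iota> n Q a b"
  using assms(1)
proof (induction m arbitrary: P)
  case 0
  then obtain c where "P = [:c:]" by (metis degree_0_id le_zero_eq)
  then show ?case by (simp add: bform_0 bform_smult)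
next
  case (Suc m)
  obtain c P' where P: "P = pCons c P'" by (cases P)
  with Suc.prems have P': "degree P' \<le> m" by (cases "P' = 0") auto
  have "bform \<iota> (Suc m + n) (P * Q) a b =
      \<iota> c * bform \<iota> (Suc m + n) Q a b + bform \<iota> (Suc (m + n)) (pCons 0 (P' * Q)) a b"
    by (simp add: P bform_add bform_smult)
  also have "\<dots> = \<iota> c * (a ^ Suc m * bform \<iota> n Q a b) + b * (bform \<iota> m P' a b * bform \<iota> n Q a b)"
    using Suc.IH [OF P'] by (simp only: bform_raise [OF assms(2)] bform_pCons) simp
  also have "\<dots> = bform \<iota> (Suc m) P a b * bform \<iota> n Q a b"
    by (simp add: P bform_pCons algebra_simps)
  finally show ?case .
qed

lemma bform_monom: "i \<le> k \<Longrightarrow> bform \<iota> k (monom c i) a b = \<iota> c * a ^ (k - i) * b ^ i"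
proof -
  assume "i \<le> k"
  have "bform \<iota> k (monom c i) a b = (\<Sum>j\<le>k. if j = i then \<iota> c * a ^ (k - i) * b ^ i else 0)"
    unfolding bform_def by (intro sum.cong) auto
  then show ?thesis using \<open>i \<le> k\<close> by simp
qed

lemma bform_1: "bform \<iota> k 1 a b = a ^ k"
  using bform_monom [of 0 k 1] by simp

end

lemma pconst_hom: "comm_ring_hom (\<lambda>c::complex. [:c:])"
  by unfold_locales (simp_all add: one_pCons)

lemma ident_hom: "comm_ring_hom (\<lambda>c::complex. c)"
  by unfold_locales simp_all

lemma poly_bform:
  "poly (bform (\<lambda>c. [:c:]) k Q A B) z = bform (\<lambda>c. c) k Q (poly A z) (poly B z)"
  by (simp add: bform_def poly_sum mult.assoc)

lemma bform_one:
  assumes "degree Q \<le> k"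
  shows "bform (\<lambda>c. c) k Q 1 z = poly Q z"
proof -
  have "poly Q z = (\<Sum>i\<le>k. coeff Q i * z ^ i)"
    unfolding poly_altdef using assms
    by (intro sum.mono_neutral_left) (auto simp: coeff_eq_0)
  then show ?thesis by (simp add: bform_def)
qed

lemma bform_dehom:
  assumes "degree Q \<le> k"
  shows "bform (\<lambda>c. [:c:]) k Q 1 [:0, c:] = Q \<circ>\<^sub>p [:0, c:]"
  by (rule poly_ext) (simp add: poly_bform poly_pcompose bform_one [OF assms])

section \<open>The two group generators acting on binary forms, and the octahedral forms\<close>

definition rsqrt2 :: complex where "rsqrt2 = complex_of_real (1 / sqrt 2)"

lemma rsqrt2_sq: "rsqrt2 * rsqrt2 = 1 / 2"
  by (simp add: rsqrt2_def flip: of_real_mult)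

lemma rsqrt2_neq_0: "rsqrt2 \<noteq> 0"
  using rsqrt2_sq by auto

lemma rsqrt2_power: "rsqrt2 ^ (2 * n) = 1 / 2 ^ n"
  by (simp add: power_mult power2_eq_square rsqrt2_sq power_divide)

text \<open>\<open>u\<close> and \<open>\<epsilon>\<close> are the factors by which diag(1, \<i>)
  and the MacWilliams matrix multiply the form of degree \<open>k\<close>. The transformed form is
  dehomogenized as well, so its arguments are linear polynomials.\<close>

definition semi_invariant :: "nat \<Rightarrow> complex \<Rightarrow> complex \<Rightarrow> complex poly \<Rightarrow> bool" where
  "semi_invariant k u \<epsilon> Q \<longleftrightarrow> degree Q \<le> k \<and> Q \<circ>\<^sub>p [:0, \<i>:] = Polynomial.smult u Q \<and>
     bform (\<lambda>c. [:c:]) k Q [:rsqrt2, rsqrt2:] [:rsqrt2, - rsqrt2:] = Polynomial.smult \<epsilon> Q"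

text \<open>Klein's octahedral forms: the roots of \<open>f6\<close>, \<open>W8\<close>,
  \<open>h12\<close> are the vertices, face centres and edge midpoints of an octahedron on the
  Riemann sphere. As a form of degree 6, \<open>f6\<close> also vanishes at infinity, so its
  polynomial has degree 5.\<close>

definition f6 :: "complex poly" where "f6 = [:0, 1, 0, 0, 0, -1:]"
definition W8 :: "complex poly" where "W8 = [:1, 0, 0, 0, 14, 0, 0, 0, 1:]"
definition h12 :: "complex poly" where "h12 = [:1, 0, 0, 0, -33, 0, 0, 0, -33, 0, 0, 0, 1:]"

lemma degree_f6: "degree f6 = 5" and degree_W8: "degree W8 = 8" and degree_h12: "degree h12 = 12"
  by (simp_all add: f6_def W8_def h12_def)

context
  fixes \<iota> :: "complex \<Rightarrow> 'a::comm_ring_1"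
  assumes \<iota>: "comm_ring_hom \<iota>"
begin

interpretation \<iota>: comm_ring_hom \<iota> by (rule \<iota>)

lemma bform_f6: "bform \<iota> 6 f6 a b = a * b * (a ^ 4 - b ^ 4)"
proof -
  have *: "f6 = monom 1 1 + monom (-1) 5"
    by (simp add: f6_def monom_altdef power_numeral_reduce)
  show ?thesis unfolding *
    by (simp add: bform_1 [OF \<iota>] bform_add [OF \<iota>] bform_monom [OF \<iota>] \<iota>.hom_uminus algebra_simps power_numeral_reduce)
qed

lemma bform_W8: "bform \<iota> 8 W8 a b = a ^ 8 + 14 * a ^ 4 * b ^ 4 + b ^ 8"
proof -
  have *: "W8 = 1 + monom 14 4 + monom 1 8"
    by (simp add: W8_def monom_altdef power_numeral_reduce one_pCons)
  show ?thesis unfolding *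
    by (simp add: bform_1 [OF \<iota>] bform_add [OF \<iota>] bform_monom [OF \<iota>] \<iota>.hom_numeral)
qed

lemma bform_h12: "bform \<iota> 12 h12 a b = a ^ 12 - 33 * a ^ 8 * b ^ 4 - 33 * a ^ 4 * b ^ 8 + b ^ 12"
proof -
  have *: "h12 = 1 + monom (-33) 4 + monom (-33) 8 + monom 1 12"
    by (simp add: h12_def monom_altdef power_numeral_reduce one_pCons)
  show ?thesis unfolding *
    by (simp add: bform_1 [OF \<iota>] bform_add [OF \<iota>] bform_monom [OF \<iota>] \<iota>.hom_numeral \<iota>.hom_uminus)
qed

end

text \<open>Polynomials are compared by their values, and homogeneity takes the factor
  \<open>rsqrt2\<close> out of both arguments.\<close>

lemma semi_invariantI:
  assumes "degree Q \<le> k" "\<And>z. poly Q (\<i> * z) = u * poly Q z"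
    and "\<And>z. bform (\<lambda>c. c) k Q (1 + z) (1 - z) * rsqrt2 ^ k = \<epsilon> * poly Q z"
  shows "semi_invariant k u \<epsilon> Q"
  unfolding semi_invariant_def
proof (intro conjI poly_ext)
  fix z
  show "poly (Q \<circ>\<^sub>p [:0, \<i>:]) z = poly (Polynomial.smult u Q) z"
    using assms(2) [of z] by (simp add: poly_pcompose mult.commute)
  have "poly (bform (\<lambda>c. [:c:]) k Q [:rsqrt2, rsqrt2:] [:rsqrt2, - rsqrt2:]) z =
      bform (\<lambda>c. c) k Q (rsqrt2 * (1 + z)) (rsqrt2 * (1 - z))"
    by (simp add: poly_bform algebra_simps)
  then show "poly (bform (\<lambda>c. [:c:]) k Q [:rsqrt2, rsqrt2:] [:rsqrt2, - rsqrt2:]) z = poly (Polynomial.smult \<epsilon> Q) z"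
    using assms(3) [of z] by (simp add: bform_scale mult.commute)
qed fact

lemma semi_invariant_f6: "semi_invariant 6 \<i> 1 f6"
proof (rule semi_invariantI)
  show "bform (\<lambda>c. c) 6 f6 (1 + z) (1 - z) * rsqrt2 ^ 6 = 1 * poly f6 z" for z
  proof -
    have r: "rsqrt2 ^ 6 = 1 / 8" using rsqrt2_power [of 3] by simp
    show ?thesis unfolding bform_f6 [OF ident_hom] r
      by (simp add: f6_def algebra_simps power_numeral_reduce)
  qed
qed (simp_all add: f6_def algebra_simps power_numeral_reduce)

lemma semi_invariant_W8: "semi_invariant 8 1 1 W8"
proof (rule semi_invariantI)
  show "bform (\<lambda>c. c) 8 W8 (1 + z) (1 - z) * rsqrt2 ^ 8 = 1 * poly W8 z" for z
  proof -
    have r: "rsqrt2 ^ 8 = 1 / 16" using rsqrt2_power [of 4] by simp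
    show ?thesis unfolding bform_W8 [OF ident_hom] r
      by (simp add: W8_def algebra_simps power_numeral_reduce)
  qed
qed (simp_all add: W8_def algebra_simps power_numeral_reduce)

lemma semi_invariant_h12: "semi_invariant 12 1 (-1) h12"
proof (rule semi_invariantI)
  show "bform (\<lambda>c. c) 12 h12 (1 + z) (1 - z) * rsqrt2 ^ 12 = - 1 * poly h12 z" for z
  proof -
    have r: "rsqrt2 ^ 12 = 1 / 64" using rsqrt2_power [of 6] by simp
    show ?thesis unfolding bform_h12 [OF ident_hom] r
      by (simp add: h12_def algebra_simps power_numeral_reduce)
  qed
qed (simp_all add: h12_def algebra_simps power_numeral_reduce)

lemma semi_invariant_mult:
  assumes "semi_invariant m u \<epsilon> P" "semi_invariant n v \<eta> Q"
  shows "semi_invariant (m + n) (u * v) (\<epsilon> * \<eta>) (P * Q)"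
  using assms order_trans [OF degree_mult_le [of P Q] add_mono [of "degree P" m "degree Q" n]]
  unfolding semi_invariant_def
  by (simp add: pcompose_mult bform_mult [OF pconst_hom] mult.commute)

lemma semi_invariant_diff:
  assumes "semi_invariant k u \<epsilon> P" "semi_invariant k u \<epsilon> Q"
  shows "semi_invariant k u \<epsilon> (P - Polynomial.smult a Q)"
proof -
  have "P - Polynomial.smult a Q = P + Polynomial.smult (- a) Q" by simp
  moreover have "degree (P + Polynomial.smult (- a) Q) \<le> k"
    using assms by (intro degree_add_le) (auto simp: semi_invariant_def)
  ultimately show ?thesis using assms
    by (simp only: semi_invariant_def pcompose_add pcompose_smult bform_add [OF pconst_hom]
        bform_smult [OF pconst_hom] smult_add_right)
      (simp add: mult.commute)
qed

text \<open>The sextic has multipliers \<i> and 1, and complex polynomials form an integral domain,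
  so the first multiplier is divided by \<i> and the second is kept.\<close>

lemma semi_invariant_cancel_f6:
  assumes "semi_invariant (6 + k) u \<epsilon> (f6 * Q)" "degree Q \<le> k"
  shows "semi_invariant k (- \<i> * u) \<epsilon> Q"
proof -
  have f6: "f6 \<noteq> 0" by (simp add: f6_def)
  have f6c: "f6 \<circ>\<^sub>p [:0, \<i>:] = Polynomial.smult \<i> f6"
    and f6b: "bform (\<lambda>c. [:c:]) 6 f6 [:rsqrt2, rsqrt2:] [:rsqrt2, - rsqrt2:] = f6"
    using semi_invariant_f6 by (auto simp: semi_invariant_def)
  have "f6 * Polynomial.smult \<i> (Q \<circ>\<^sub>p [:0, \<i>:]) = f6 * Polynomial.smult u Q"
    using assms(1) by (simp add: semi_invariant_def pcompose_mult f6c)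
  then have "Polynomial.smult \<i> (Q \<circ>\<^sub>p [:0, \<i>:]) = Polynomial.smult u Q"
    using f6 mult_cancel_left by blast
  then have "Polynomial.smult (- \<i>) (Polynomial.smult \<i> (Q \<circ>\<^sub>p [:0, \<i>:])) = Polynomial.smult (- \<i>) (Polynomial.smult u Q)"
    by simp
  then have c: "Q \<circ>\<^sub>p [:0, \<i>:] = Polynomial.smult (- \<i> * u) Q" by simp
  have "degree f6 \<le> 6" by (simp add: degree_f6)
  then have "f6 * bform (\<lambda>c. [:c:]) k Q [:rsqrt2, rsqrt2:] [:rsqrt2, - rsqrt2:] = f6 * Polynomial.smult \<epsilon> Q"
    using assms by (simp add: semi_invariant_def bform_mult [OF pconst_hom] f6b)
  then have "bform (\<lambda>c. [:c:]) k Q [:rsqrt2, rsqrt2:] [:rsqrt2, - rsqrt2:] = Polynomial.smult \<epsilon> Q"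
    using f6 mult_cancel_left by blast
  with c assms(2) show ?thesis by (simp add: semi_invariant_def)
qed

lemma semi_invariant_eval:
  assumes "semi_invariant k u \<epsilon> Q"
  shows "poly Q (\<i> * z) = u * poly Q z"
    and "bform (\<lambda>c. c) k Q (rsqrt2 * (1 + z)) (rsqrt2 * (1 - z)) = \<epsilon> * poly Q z"
proof -
  have "poly (Q \<circ>\<^sub>p [:0, \<i>:]) z = u * poly Q z"
    using assms by (simp add: semi_invariant_def)
  then show "poly Q (\<i> * z) = u * poly Q z" by (simp add: poly_pcompose mult.commute)
  have "poly (bform (\<lambda>c. [:c:]) k Q [:rsqrt2, rsqrt2:] [:rsqrt2, - rsqrt2:]) z = \<epsilon> * poly Q z"
    using assms by (simp add: semi_invariant_def)
  then show "bform (\<lambda>c. c) k Q (rsqrt2 * (1 + z)) (rsqrt2 * (1 - z)) = \<epsilon> * poly Q z"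
    by (simp add: poly_bform algebra_simps)
qed

text \<open>The MacWilliams matrix acts on the projective line by z -> (1 - z) / (1 + z), taking 0
  to 1, \<i> to -\<i> and -1 to infinity. The value at infinity is the coefficient of index
  \<open>k\<close>.\<close>

lemma semi_invariant_special:
  assumes "semi_invariant k u \<epsilon> Q"
  shows "rsqrt2 ^ k * poly Q 1 = \<epsilon> * coeff Q 0"
    and "(rsqrt2 * (1 + \<i>)) ^ k * poly Q (- \<i>) = \<epsilon> * poly Q \<i>"
    and "(2 * rsqrt2) ^ k * coeff Q k = \<epsilon> * poly Q (- 1)"
proof -
  have deg: "degree Q \<le> k" using assms by (simp add: semi_invariant_def)
  show "rsqrt2 ^ k * poly Q 1 = \<epsilon> * coeff Q 0"
    using semi_invariant_eval(2) [OF assms, of 0] bform_scale [of _ k Q rsqrt2 1 1] bform_one [OF deg, of 1]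
    by (simp add: poly_0_coeff_0)
  have "rsqrt2 * (1 - \<i>) = rsqrt2 * (1 + \<i>) * (- \<i>)"
    by (simp add: algebra_simps)
  then show "(rsqrt2 * (1 + \<i>)) ^ k * poly Q (- \<i>) = \<epsilon> * poly Q \<i>"
    using semi_invariant_eval(2) [OF assms, of \<i>] bform_scale [of _ k Q "rsqrt2 * (1 + \<i>)" 1 "- \<i>"]
      bform_one [OF deg, of "- \<i>"] by simp
  have "bform (\<lambda>c. c) k Q 0 c = c ^ k * coeff Q k" for c :: complex
  proof -
    have "bform (\<lambda>c. c) k Q 0 c = (\<Sum>i\<le>k. if i = k then coeff Q k * c ^ k else 0)"
      unfolding bform_def by (intro sum.cong) (auto simp: power_0_left)
    then show ?thesis by simp
  qed
  then show "(2 * rsqrt2) ^ k * coeff Q k = \<epsilon> * poly Q (- 1)"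
    using semi_invariant_eval(2) [OF assms, of "- 1"] by (simp add: mult.commute)
qed

text \<open>The six points 0, infinity, 1, -1, \<i>, -\<i> form one orbit of the group. A
  semi-invariant that vanishes at 0 therefore vanishes at all of them, and these are the roots of
  \<open>f6\<close>.\<close>

lemma semi_invariant_div_f6:
  assumes "semi_invariant k u \<epsilon> Q" "coeff Q 0 = 0" "Q \<noteq> 0"
  obtains k' Q' where "k = 6 + k'" "Q = f6 * Q'" "semi_invariant k' (- \<i> * u) \<epsilon> Q'"
proof -
  have 0: "poly Q 0 = 0" using assms(2) by (simp add: poly_0_coeff_0)
  have 1: "poly Q 1 = 0"
    using semi_invariant_special(1) [OF assms(1)] assms(2) rsqrt2_neq_0 by simp
  have i: "poly Q \<i> = 0" using semi_invariant_eval(1) [OF assms(1), of 1] 1 by simp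
  have m1: "poly Q (- 1) = 0" using semi_invariant_eval(1) [OF assms(1), of \<i>] i by simp
  have mi: "poly Q (- \<i>) = 0" using semi_invariant_eval(1) [OF assms(1), of "- 1"] m1 by simp
  have top: "coeff Q k = 0"
    using semi_invariant_special(3) [OF assms(1)] m1 rsqrt2_neq_0 by simp
  have step: "\<exists>R'. R = [:- a, 1:] * R'" if "poly R a = 0" for R and a :: complex
    using that by (auto simp: poly_eq_0_iff_dvd dvd_def)
  obtain R1 where R1: "Q = [:- 0, 1:] * R1" using step 0 by blast
  have "poly R1 1 = 0" using 1 unfolding R1 by simp
  then obtain R2 where R2: "R1 = [:- 1, 1:] * R2" using step by blast
  have "poly R2 (- 1) = 0" using m1 unfolding R1 R2 by simp
  then obtain R3 where R3: "R2 = [:- (- 1), 1:] * R3" using step by blast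
  have "poly R3 \<i> = 0" using i unfolding R1 R2 R3 by (simp add: complex_eq_iff)
  then obtain R4 where R4: "R3 = [:- \<i>, 1:] * R4" using step by blast
  have "poly R4 (- \<i>) = 0" using mi unfolding R1 R2 R3 R4 by (simp add: complex_eq_iff)
  then obtain R5 where R5: "R4 = [:- (- \<i>), 1:] * R5" using step by blast
  have "Q = f6 * - R5"
    unfolding R1 R2 R3 R4 R5 f6_def
    by (rule poly_ext) (simp add: algebra_simps power_numeral_reduce)
  then obtain Q' where Q': "Q = f6 * Q'" by blast
  with assms(3) have "Q' \<noteq> 0" by auto
  then have dQ: "degree Q = 5 + degree Q'" unfolding Q'
    by (subst degree_mult_eq) (auto simp: degree_f6 f6_def)
  \<comment> \<open>The root at infinity makes the degree of \<open>Q\<close> smaller than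
    \<open>k\<close>; this supplies the sixth degree that \<open>f6\<close>, of degree 5, does not
    remove.\<close>
  have "degree Q \<noteq> k" using top assms(3) by auto
  moreover have "degree Q \<le> k" using assms(1) by (simp add: semi_invariant_def)
  ultimately have k: "k = 6 + (k - 6)" "degree Q' \<le> k - 6" using dQ by auto
  then have "semi_invariant (k - 6) (- \<i> * u) \<epsilon> Q'"
    using assms(1) Q' by (metis semi_invariant_cancel_f6)
  with k(1) Q' show thesis by (rule that)
qed

section \<open>Divisibility by powers of the sextic and the resulting module structure\<close>

lemma i_power_neq_1: "c < 3 \<Longrightarrow> \<i> ^ Suc c \<noteq> 1"
proof -
  assume "c < 3"
  then consider "c = 0" | "c = 1" | "c = 2" by linarith
  then show ?thesis by cases (simp_all add: complex_eq_iff power_numeral_reduce)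
qed

text \<open>At the fixed point 0 of diag(1, \<i>), a multiplier other than 1 forces the value 0. So
  one factor \<open>f6\<close> splits off at a time, until the multiplier is 1.\<close>

lemma semi_invariant_div_f6_power:
  assumes "semi_invariant k (\<i> ^ c) \<epsilon> Q" "c < 4" "Q \<noteq> 0"
  obtains k' Q' where "k = 6 * c + k'" "Q = f6 ^ c * Q'" "semi_invariant k' 1 \<epsilon> Q'"
  using assms
proof (induction c arbitrary: k Q thesis)
  case 0
  show ?case by (rule "0.prems"(1) [of k Q]) (use "0.prems" in simp_all)
next
  case (Suc c)
  have "coeff Q 0 = 0"
    using semi_invariant_eval(1) [OF Suc.prems(2), of 0] i_power_neq_1 [of c] Suc.prems(3)
    by (simp add: poly_0_coeff_0)
  from semi_invariant_div_f6 [OF Suc.prems(2) this Suc.prems(4)]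
  obtain k1 Q1 where 1: "k = 6 + k1" "Q = f6 * Q1" "semi_invariant k1 (- \<i> * \<i> ^ Suc c) \<epsilon> Q1" .
  have "- \<i> * \<i> ^ Suc c = \<i> ^ c" by simp
  with 1 Suc.prems have "semi_invariant k1 (\<i> ^ c) \<epsilon> Q1" "c < 4" "Q1 \<noteq> 0" by auto
  then obtain k' Q' where "k1 = 6 * c + k'" "Q1 = f6 ^ c * Q'" "semi_invariant k' 1 \<epsilon> Q'"
    using Suc.IH by blast
  then show ?case using 1 by (intro Suc.prems(1) [of k' Q']) (auto simp: mult.assoc)
qed

text \<open>The graded module generated by \<open>P0\<close> over the ring of polynomials in
  \<open>W8\<close> and \<open>f6 ^ 4\<close>. The degree is an index of its own because a
  dehomogenized form does not determine it.\<close>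

inductive form_module :: "nat \<Rightarrow> complex poly \<Rightarrow> nat \<Rightarrow> complex poly \<Rightarrow> bool" for k0 P0 where
  base: "form_module k0 P0 k0 P0"
| zero: "form_module k0 P0 k 0"
| add: "form_module k0 P0 k P \<Longrightarrow> form_module k0 P0 k Q \<Longrightarrow> form_module k0 P0 k (P + Q)"
| smult: "form_module k0 P0 k Q \<Longrightarrow> form_module k0 P0 k (Polynomial.smult a Q)"
| W8: "form_module k0 P0 k Q \<Longrightarrow> form_module k0 P0 (8 + k) (W8 * Q)"
| f6: "form_module k0 P0 k Q \<Longrightarrow> form_module k0 P0 (24 + k) (f6 ^ 4 * Q)"

lemma zeta8_powers:
  fixes z :: complex
  defines "z \<equiv> rsqrt2 * (1 + \<i>)"
  shows "z ^ 4 = -1" "z \<noteq> 1" "z \<noteq> -1" "z\<^sup>2 = \<i>"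
proof -
  show z2: "z\<^sup>2 = \<i>"
    using rsqrt2_sq by (simp add: z_def power2_eq_square algebra_simps)
  have "z ^ 4 = (z\<^sup>2) ^ 2" by simp
  then show "z ^ 4 = -1" using z2 by simp
  show "z \<noteq> 1" "z \<noteq> -1" using z2 by (auto simp: complex_eq_iff)
qed

text \<open>The base is a primitive eighth root of unity; the exponent is reduced modulo 8 and the
  other residues are excluded one by one.\<close>

lemma zeta8_power_eq:
  assumes "(rsqrt2 * (1 + \<i>)) ^ k = \<epsilon>" "\<epsilon> = 1 \<or> \<epsilon> = -1"
  shows "\<exists>j. k = 8 * j + (if \<epsilon> = 1 then 0 else 4)"
proof -
  define z where "z = rsqrt2 * (1 + \<i>)"
  note z = zeta8_powers [folded z_def]
  have z8: "z ^ 8 = 1"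
    using power_mult [of z 4 2] z(1) by simp
  have z3: "z ^ 3 = z * \<i>" using z(4) by (simp add: power_numeral_reduce)
  have z4: "z ^ (4 + m) = - (z ^ m)" for m using z(1) by (simp add: power_add)
  have "k = 8 * (k div 8) + k mod 8" by simp
  then have "z ^ k = z ^ (k mod 8)"
    by (metis power_add power_mult power_one z8 mult_1)
  with assms(1) have e: "z ^ (k mod 8) = \<epsilon>" by (simp add: z_def)
  have zi: "z * \<i> \<noteq> 1" "z * \<i> \<noteq> -1"
    using z(2,3,4) by (auto simp: power2_eq_square complex_eq_iff)
  have "k mod 8 < 8" by simp
  then consider "k mod 8 = 0" | "k mod 8 = 1" | "k mod 8 = 2" | "k mod 8 = 3" | "k mod 8 = 4"
    | "k mod 8 = 4 + 1" | "k mod 8 = 4 + 2" | "k mod 8 = 4 + 3" by linarith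
  then have "k mod 8 = (if \<epsilon> = 1 then 0 else 4)"
  proof cases
    case 2 then show ?thesis using e assms(2) z by auto
  next
    case 3 then show ?thesis using e assms(2) z by (auto simp: complex_eq_iff)
  next
    case 4 then show ?thesis using e assms(2) z3 zi by auto
  next
    case 6 then show ?thesis using e assms(2) z z4 [of 1] by (auto simp: minus_equation_iff)
  next
    case 7 then show ?thesis using e assms(2) z z4 [of 2] by (auto simp: complex_eq_iff)
  next
    case 8 then show ?thesis using e assms(2) z3 zi z4 [of 3] by (auto simp: minus_equation_iff)
  qed (use e assms(2) z in auto)
  with \<open>k = 8 * (k div 8) + k mod 8\<close> show ?thesis by metis
qed

text \<open>The MacWilliams matrix \<open>M\<close> and \<open>S = diag(1, \<i>)\<close> satisfy \<open>(M S)\<^sup>3 = \<zeta>\<^sub>8\<close>, which restricts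
  the degree \<open>k\<close>.\<close>

lemma semi_invariant_leading:
  assumes "semi_invariant k 1 \<epsilon> Q" "\<epsilon> = 1 \<or> \<epsilon> = -1" "coeff Q 0 \<noteq> 0"
  shows "\<exists>j. k = 8 * j + (if \<epsilon> = 1 then 0 else 12)"
proof -
  note s = semi_invariant_special [OF assms(1)]
  have e: "poly Q (\<i> * z) = poly Q z" for z
    using semi_invariant_eval(1) [OF assms(1), of z] by simp
  have Q: "poly Q \<i> = poly Q 1" "poly Q (- 1) = poly Q 1" "poly Q (- \<i>) = poly Q 1"
    using e [of 1] e [of \<i>] e [of "- 1"] by simp_all
  have "poly Q 1 \<noteq> 0" using s(1) assms(2,3) rsqrt2_neq_0 by auto
  \<comment> \<open>Invariance under diag(1, \<i>) gives \<open>Q\<close> the same nonzero value at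
    \<i> and -\<i>, so the relation at the point \<i> reduces to its scalar factors.\<close>
  then have z: "(rsqrt2 * (1 + \<i>)) ^ k = \<epsilon>" using s(2) Q by simp
  from zeta8_power_eq [OF this assms(2)]
  obtain j where j: "k = 8 * j + (if \<epsilon> = 1 then 0 else 4)" by blast
  show ?thesis
  proof (cases "\<epsilon> = 1 \<or> j > 0")
    case True
    then show ?thesis
    proof (cases "\<epsilon> = 1")
      case False
      with True j have "k = 8 * (j - 1) + 12" by auto
      with False show ?thesis by auto
    qed (use j in auto)
  next
    case False
    \<comment> \<open>The one degree left to exclude is 4 with sign -1. There the form is c0 + c4
      z^4, and the special values give c0 + c4 = -4 c0 = -4 c4, hence c0 = 0.\<close>
    then have k: "k = 4" and \<epsilon>: "\<epsilon> = -1" using j assms(2) by auto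
    have deg: "degree Q \<le> 4" using assms(1) k by (simp add: semi_invariant_def)
    have c: "\<i> ^ n * coeff Q n = coeff Q n" for n
    proof -
      have "coeff (Q \<circ>\<^sub>p [:0, \<i>:]) n = coeff Q n" using assms(1) by (simp add: semi_invariant_def)
      then show ?thesis by (simp add: coeff_pcompose_linear)
    qed
    have "coeff Q 1 = 0" "coeff Q 2 = 0" "coeff Q 3 = 0"
      using c [of 1] c [of 2] c [of 3] by (auto simp: power_numeral_reduce complex_eq_iff)
    moreover have "poly Q 1 = (\<Sum>i\<le>4. coeff Q i)"
      using bform_one [OF deg, of 1] by (simp add: bform_def)
    ultimately have Q1: "poly Q 1 = coeff Q 0 + coeff Q 4"
      by (simp add: numeral_eq_Suc)
    have r: "rsqrt2 ^ 4 = 1 / 4" using rsqrt2_power [of 2] by simp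
    have "poly Q 1 = - 4 * coeff Q 0"
      using s(1) unfolding k \<epsilon> r by (simp add: field_simps)
    moreover have "4 * coeff Q 4 = - poly Q 1"
      using s(3) unfolding k \<epsilon> r power_mult_distrib Q by simp
    ultimately have "poly Q 1 = - 4 * coeff Q 0" "4 * coeff Q 4 = - poly Q 1" .
    with Q1 have "coeff Q 0 = 0" by (simp add: complex_eq_iff)
    with assms(3) show ?thesis by simp
  qed
qed

text \<open>Strong induction on the degree. A suitable multiple of \<open>W8 ^ j * P0\<close>
  removes the constant coefficient; what remains is divisible by \<open>f6 ^ 4\<close>, and the
  quotient has degree smaller by 24.\<close>

lemma semi_invariant_form_module:
  assumes "semi_invariant k 1 \<epsilon> Q" "\<epsilon> = 1 \<and> k0 = 0 \<and> P0 = 1 \<or> \<epsilon> = -1 \<and> k0 = 12 \<and> P0 = h12"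
  shows "form_module k0 P0 k Q"
  using assms(1)
proof (induction k arbitrary: Q rule: less_induct)
  case (less k)
  have one: "semi_invariant 0 1 1 1"
    by (simp add: semi_invariant_def bform_0 one_pCons pcompose_const)
  have P0: "semi_invariant k0 1 \<epsilon> P0" "coeff P0 0 = 1"
    using assms(2) semi_invariant_h12 one by (auto simp: h12_def)
  have \<epsilon>: "\<epsilon> = 1 \<or> \<epsilon> = -1" using assms(2) by auto
  have pow: "form_module k0 P0 (8 * j + k0) (W8 ^ j * P0) \<and>
      semi_invariant (8 * j + k0) 1 \<epsilon> (W8 ^ j * P0) \<and> coeff (W8 ^ j * P0) 0 = 1" for j
  proof (induction j)
    case (Suc j)
    have "coeff W8 0 = 1" by (simp add: W8_def)
    then show ?case
      using Suc form_module.W8 [of k0 P0 "8 * j + k0" "W8 ^ j * P0"]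
        semi_invariant_mult [OF semi_invariant_W8, of "8 * j + k0" 1 \<epsilon> "W8 ^ j * P0"]
      by (simp add: mult.assoc add.assoc coeff_mult_0)
  qed (use P0 form_module.base in simp)
  have small: "form_module k0 P0 k R" if R: "semi_invariant k 1 \<epsilon> R" "coeff R 0 = 0" for R
  proof (cases "R = 0")
    case False
    from semi_invariant_div_f6 [OF R False]
    obtain k1 R1 where 1: "k = 6 + k1" "R = f6 * R1" "semi_invariant k1 (- \<i> * 1) \<epsilon> R1" .
    \<comment> \<open>After one division by \<open>f6\<close> the multiplier is \<i>^3, which forces
      three further factors \<open>f6\<close>; the quotient again has multiplier 1.\<close>
    moreover have "- \<i> * 1 = \<i> ^ 3" by (simp add: power_numeral_reduce)
    moreover have "R1 \<noteq> 0" using 1 False by auto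
    moreover have "(3::nat) < 4" by simp
    ultimately obtain k2 R2 where 2: "k1 = 6 * 3 + k2" "R1 = f6 ^ 3 * R2" "semi_invariant k2 1 \<epsilon> R2"
      using semi_invariant_div_f6_power [of k1 3 \<epsilon> R1] by metis
    have "form_module k0 P0 (24 + k2) (f6 ^ 4 * R2)"
      using 1 2 by (intro form_module.f6 less.IH) auto
    moreover have "R = f6 ^ 4 * R2" "k = 24 + k2" using 1 2 by (simp_all add: power_numeral_reduce mult.assoc)
    ultimately show ?thesis by simp
  qed (simp add: form_module.zero)
  show ?case
  proof (cases "coeff Q 0 = 0")
    case False
    then obtain j where "k = 8 * j + k0"
      using semi_invariant_leading [OF less.prems \<epsilon>] assms(2) by auto
    then have g: "form_module k0 P0 k (W8 ^ j * P0)" "semi_invariant k 1 \<epsilon> (W8 ^ j * P0)"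
      "coeff (W8 ^ j * P0) 0 = 1" using pow [of j] by auto
    let ?a = "coeff Q 0"
    have "form_module k0 P0 k (Q - Polynomial.smult ?a (W8 ^ j * P0))"
      by (rule small) (use g semi_invariant_diff [OF less.prems g(2)] in auto)
    from form_module.add [OF this form_module.smult [OF g(1), of ?a]]
    show ?thesis by simp
  qed (use small less.prems in blast)
qed

section \<open>Polarization and covariants\<close>

abbreviation x0 :: jpoly where "x0 \<equiv> var (X 0)"
abbreviation x1 :: jpoly where "x1 \<equiv> var (X 1)"
abbreviation y0 :: jpoly where "y0 \<equiv> var (Y 0)"
abbreviation y1 :: jpoly where "y1 \<equiv> var (Y 1)"

lemmas const_ring_hom = const_hom.comm_ring_hom_axioms
lemmas subst_hom = psubst_hom [OF const_ring_hom]
lemmas subst_simps =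
  psubst_const [OF const_ring_hom] psubst_var [OF const_ring_hom]
  psubst_add [OF const_ring_hom] psubst_mult [OF const_ring_hom]

lemma subst_id: "psubst const var p = p"
  by (induction p rule: jpoly_induct) (simp_all add: subst_simps)

section \<open>Partial derivatives, polarization operators and bidegrees\<close>

definition pd :: "jvar \<Rightarrow> jpoly \<Rightarrow> jpoly" where
  "pd v = derivation (\<lambda>w. if w = v then 1 else 0)"

lemma pd_simps [simp]:
  "pd v (const c) = 0" "pd v (var w) = (if w = v then 1 else 0)" "pd v (p + q) = pd v p + pd v q"
  "pd v (p * q) = pd v p * q + p * pd v q" "pd v 0 = 0" "pd v (p - q) = pd v p - pd v q"
  by (simp_all add: pd_def)

lemma pd_power: "pd v (p ^ n) = of_nat n * p ^ (n - 1) * pd v p"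
  by (simp add: pd_def derivation_power)

lemma chain_rule:
  "derivation \<delta> (psubst const \<sigma> p) =
     derivation \<delta> (\<sigma> (Y 0)) * psubst const \<sigma> (pd (Y 0) p) +
     derivation \<delta> (\<sigma> (Y 1)) * psubst const \<sigma> (pd (Y 1) p) +
     derivation \<delta> (\<sigma> (X 0)) * psubst const \<sigma> (pd (X 0) p) +
     derivation \<delta> (\<sigma> (X 1)) * psubst const \<sigma> (pd (X 1) p)" (is "?L p = ?R p")
proof (induction p rule: jpoly_induct)
  case (const c)
  then show ?case using subst_simps(1) [of \<sigma> 0] by (simp add: subst_simps)
next
  case (var v)
  have "\<forall>v. ?L (var v) = ?R (var v)"
    using subst_simps(1) [of \<sigma> 0] subst_simps(1) [of \<sigma> 1] by (simp add: all_jvar subst_simps)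
  then show ?case by blast
qed (simp_all add: subst_simps algebra_simps)

definition polar :: "jpoly \<Rightarrow> jpoly" where
  "polar = derivation (case_jvar (\<lambda>_. 0) (\<lambda>a. var (Y a)))"

lemma polar_simps [simp]:
  "polar (const c) = 0" "polar (var (X a)) = var (Y a)" "polar (var (Y a)) = 0"
  "polar (p + q) = polar p + polar q" "polar (p * q) = polar p * q + p * polar q"
  "polar 0 = 0" "polar 1 = 0" "polar (numeral k) = 0" "polar (p - q) = polar p - polar q"
  by (simp_all add: polar_def)

lemma polar_power: "polar (p ^ n) = of_nat n * p ^ (n - 1) * polar p"
  by (simp add: polar_def derivation_power)

lemma polar_eq: "polar p = y0 * pd (X 0) p + y1 * pd (X 1) p"
  using chain_rule [of "case_jvar (\<lambda>_. 0) (\<lambda>a. var (Y a))" var p]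
  by (simp add: subst_id polar_def)

text \<open>In the notation of the introduction, E is \<open>polar\<close>, F is
  \<open>copolar\<close>, \<Omega> is \<open>omega\<close> and D is \<open>bracket\<close>.\<close>

definition copolar :: "jpoly \<Rightarrow> jpoly" where
  "copolar p = x0 * pd (Y 0) p + x1 * pd (Y 1) p"

definition omega :: "jpoly \<Rightarrow> jpoly" where
  "omega p = pd (X 0) (pd (Y 1) p) - pd (X 1) (pd (Y 0) p)"

definition bracket :: jpoly where "bracket = x0 * y1 - x1 * y0"

inductive bihom :: "nat \<Rightarrow> nat \<Rightarrow> jpoly \<Rightarrow> bool" for j k where
  zero: "bihom j k 0"
| add: "bihom j k p \<Longrightarrow> bihom j k q \<Longrightarrow> bihom j k (p + q)"
| monomial: "a + b = j \<Longrightarrow> d + e = k \<Longrightarrow> bihom j k (const c * (y0 ^ a * y1 ^ b * (x0 ^ d * x1 ^ e)))"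

lemma bihom_var_mult:
  assumes "bihom j k p"
  shows "bihom j (Suc k) (x0 * p)" "bihom j (Suc k) (x1 * p)"
  using assms
proof (induction)
  case (monomial a b d e c)
  {
    case 1
    show ?case using bihom.monomial [of a b j "Suc d" e "Suc k" c] monomial
      by (simp add: algebra_simps)
  next
    case 2
    show ?case using bihom.monomial [of a b j d "Suc e" "Suc k" c] monomial
      by (simp add: algebra_simps)
  }
qed (simp_all add: bihom.zero bihom.add distrib_left)

lemma pd_monomial:
  "pd (X 0) (const c * (y0 ^ a * y1 ^ b * (x0 ^ d * x1 ^ e))) =
     const (c * of_nat d) * (y0 ^ a * y1 ^ b * (x0 ^ (d - 1) * x1 ^ e))"
  "pd (X 1) (const c * (y0 ^ a * y1 ^ b * (x0 ^ d * x1 ^ e))) =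
     const (c * of_nat e) * (y0 ^ a * y1 ^ b * (x0 ^ d * x1 ^ (e - 1)))"
  "pd (Y 0) (const c * (y0 ^ a * y1 ^ b * (x0 ^ d * x1 ^ e))) =
     const (c * of_nat a) * (y0 ^ (a - 1) * y1 ^ b * (x0 ^ d * x1 ^ e))"
  "pd (Y 1) (const c * (y0 ^ a * y1 ^ b * (x0 ^ d * x1 ^ e))) =
     const (c * of_nat b) * (y0 ^ a * y1 ^ (b - 1) * (x0 ^ d * x1 ^ e))"
  by (simp_all add: pd_power const_hom.hom_mult const_hom.hom_of_nat mult_ac)

text \<open>A monomial free of the variable has derivative 0, which has every bidegree; hence the
  truncated difference \<open>k - 1\<close> is correct for \<open>k = 0\<close> too.\<close>

lemma bihom_pd_X:
  assumes "bihom j k p"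
  shows "bihom j (k - 1) (pd (X 0) p)" "bihom j (k - 1) (pd (X 1) p)"
  using assms
proof (induction)
  case (monomial a b d e c)
  {
    case 1
    show ?case unfolding pd_monomial
      using monomial by (cases d) (auto intro: bihom.monomial bihom.zero)
  next
    case 2
    show ?case unfolding pd_monomial
      using monomial by (cases e) (auto intro: bihom.monomial bihom.zero)
  }
qed (simp_all add: bihom.zero bihom.add)

lemma bihom_pd_Y:
  assumes "bihom j k p"
  shows "bihom (j - 1) k (pd (Y 0) p)" "bihom (j - 1) k (pd (Y 1) p)"
  using assms
proof (induction)
  case (monomial a b d e c)
  {
    case 1
    show ?case unfolding pd_monomial
      using monomial by (cases a) (auto intro: bihom.monomial bihom.zero)
  next
    case 2
    show ?case unfolding pd_monomial
      using monomial by (cases b) (auto intro: bihom.monomial bihom.zero)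
  }
qed (simp_all add: bihom.zero bihom.add)

lemma bihom_diff:
  assumes "bihom j k p" "bihom j k q"
  shows "bihom j k (p - q)"
proof -
  have "bihom j k (- q)" using assms(2)
  proof (induction)
    case (monomial a b d e c)
    then show ?case using bihom.monomial [of a b j d e k "- c"] by (simp add: const_hom.hom_uminus)
  qed (use bihom.add [of j k] in \<open>force intro: bihom.zero\<close>)+
  then show ?thesis using bihom.add [OF assms(1)] by fastforce
qed

lemma power_pred: "x * (of_nat n * x ^ (n - 1)) = of_nat n * x ^ n" for x :: "'a::comm_ring_1"
  by (cases n) (simp_all add: algebra_simps)

lemma euler_X:
  assumes "bihom j k p"
  shows "x0 * pd (X 0) p + x1 * pd (X 1) p = of_nat k * p"
  using assms
proof (induction)
  case (monomial a b d e c)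
  let ?m = "const c * (y0 ^ a * y1 ^ b)"
  have "x0 * pd (X 0) (?m * (x0 ^ d * x1 ^ e)) = ?m * (x0 * (of_nat d * x0 ^ (d - 1)) * x1 ^ e)"
    by (simp add: pd_power mult_ac)
  moreover have "x1 * pd (X 1) (?m * (x0 ^ d * x1 ^ e)) = ?m * (x0 ^ d * (x1 * (of_nat e * x1 ^ (e - 1))))"
    by (simp add: pd_power mult_ac)
  ultimately show ?case using monomial(2)
    by (simp only: power_pred mult.assoc) (simp add: algebra_simps flip: monomial(2))
qed (simp_all add: algebra_simps)

lemma euler_Y:
  assumes "bihom j k p"
  shows "y0 * pd (Y 0) p + y1 * pd (Y 1) p = of_nat j * p"
  using assms
proof (induction)
  case (monomial a b d e c)
  let ?m = "x0 ^ d * x1 ^ e"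
  have "y0 * pd (Y 0) (const c * (y0 ^ a * y1 ^ b * ?m)) =
      const c * (y0 * (of_nat a * y0 ^ (a - 1)) * (y1 ^ b * ?m))"
    by (simp add: pd_power mult_ac)
  moreover have "y1 * pd (Y 1) (const c * (y0 ^ a * y1 ^ b * ?m)) =
      const c * (y0 ^ a * (y1 * (of_nat b * y1 ^ (b - 1))) * ?m)"
    by (simp add: pd_power mult_ac)
  ultimately show ?case
    by (simp only: power_pred mult.assoc) (simp add: algebra_simps flip: monomial(1))
qed (simp_all add: algebra_simps)

lemma capelli:
  assumes "bihom (Suc j) k p"
  shows "bracket * omega p + polar (copolar p) = of_nat (Suc k * Suc j) * p"
proof -
  have Y: "bihom j k (pd (Y 0) p)" "bihom j k (pd (Y 1) p)"
    using bihom_pd_Y [OF assms] by simp_all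
  \<comment> \<open>The products that pair an x and a y of different index in front of the
    derivatives crosswise cancel; Euler operators in x, applied to the y-derivatives of
    \<open>p\<close>, remain.\<close>
  have "bracket * omega p + polar (copolar p) =
      (y0 * pd (Y 0) p + y1 * pd (Y 1) p) +
      y0 * (x0 * pd (X 0) (pd (Y 0) p) + x1 * pd (X 1) (pd (Y 0) p)) +
      y1 * (x0 * pd (X 0) (pd (Y 1) p) + x1 * pd (X 1) (pd (Y 1) p))"
    unfolding bracket_def omega_def copolar_def
    by (simp add: polar_eq [of "pd _ _"] algebra_simps)
  \<comment> \<open>The y-derivatives still have x-degree \<open>k\<close>, so their Euler sums add
    \<open>k\<close> copies of the y-Euler sum of \<open>p\<close> to the one already
    present.\<close>
  also have "\<dots> = of_nat (Suc k) * (y0 * pd (Y 0) p + y1 * pd (Y 1) p)"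
    by (simp only: euler_X [OF Y(1)] euler_X [OF Y(2)]) (simp add: algebra_simps)
  also have "\<dots> = of_nat (Suc k * Suc j) * p"
    by (simp only: euler_Y [OF assms] of_nat_mult mult.assoc)
  finally show ?thesis .
qed

section \<open>Simultaneous linear substitutions and covariants\<close>

fun lin_images :: "complex \<Rightarrow> complex \<Rightarrow> complex \<Rightarrow> complex \<Rightarrow> jvar \<Rightarrow> jpoly" where
  "lin_images a b c d (X t) = (if t = 0 then const a * x0 + const b * x1 else const c * x0 + const d * x1)"
| "lin_images a b c d (Y t) = (if t = 0 then const a * y0 + const b * y1 else const c * y0 + const d * y1)"

abbreviation lin_subst :: "complex \<Rightarrow> complex \<Rightarrow> complex \<Rightarrow> complex \<Rightarrow> jpoly \<Rightarrow> jpoly" where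
  "lin_subst a b c d \<equiv> psubst const (lin_images a b c d)"

lemma pd_lin_subst:
  "pd (X 0) (lin_subst a b c d p) = lin_subst a b c d (const a * pd (X 0) p + const c * pd (X 1) p)"
  "pd (X 1) (lin_subst a b c d p) = lin_subst a b c d (const b * pd (X 0) p + const d * pd (X 1) p)"
  "pd (Y 0) (lin_subst a b c d p) = lin_subst a b c d (const a * pd (Y 0) p + const c * pd (Y 1) p)"
  "pd (Y 1) (lin_subst a b c d p) = lin_subst a b c d (const b * pd (Y 0) p + const d * pd (Y 1) p)"
  by (subst pd_def, subst chain_rule, simp add: subst_simps)+

text \<open>The y-derivatives transform contragrediently to x0, x1, so pairing the two commutes with
  the substitution.\<close>

lemma copolar_lin_subst: "copolar (lin_subst a b c d p) = lin_subst a b c d (copolar p)"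
  by (simp add: copolar_def pd_lin_subst subst_simps algebra_simps)

text \<open>\<open>omega\<close> is a 2 by 2 determinant of derivatives, and both its rows are
  transformed by the transposed matrix.\<close>

lemma omega_lin_subst:
  "omega (lin_subst a b c d p) = const (a * d - b * c) * lin_subst a b c d (omega p)"
proof -
  interpret s: comm_ring_hom "lin_subst a b c d" by (rule subst_hom)
  show ?thesis
    by (simp add: omega_def pd_lin_subst subst_simps s.hom_minus const_hom.hom_minus const_hom.hom_mult algebra_simps)
qed

text \<open>As the two substitutions have determinants \<open>-1\<close> and \<open>\<i>\<close>, this says that \<open>bracket ^ b * q\<close> is
  invariant under them.\<close>

definition covariant :: "nat \<Rightarrow> jpoly \<Rightarrow> bool" where
  "covariant b q \<longleftrightarrow> lin_subst rsqrt2 rsqrt2 rsqrt2 (- rsqrt2) q = const ((- 1) ^ b) * q \<and>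
     lin_subst 1 0 0 \<i> q = const ((- \<i>) ^ b) * q"

lemma copolar_const_mult: "copolar (const c * p) = const c * copolar p"
  by (simp add: copolar_def algebra_simps)

lemma omega_const_mult: "omega (const c * p) = const c * omega p"
  by (simp add: omega_def algebra_simps)

lemma covariant_copolar: "covariant b q \<Longrightarrow> covariant b (copolar q)"
  by (simp add: covariant_def copolar_const_mult flip: copolar_lin_subst)

text \<open>Each substitution contributes the inverse of its determinant, -1 or -\<i>, which is one
  more factor of the character.\<close>

lemma covariant_omega:
  assumes "covariant b q"
  shows "covariant (Suc b) (omega q)"
proof -
  have *: "const (u * v) * p = const u * (const v * p)" for u v p
    by (simp add: const_hom.hom_mult mult.assoc)
  have det: "rsqrt2 * - rsqrt2 - rsqrt2 * rsqrt2 = - 1"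
    by (simp add: rsqrt2_sq)
  have "const ((- 1) ^ b) * omega q = const (- 1) * lin_subst rsqrt2 rsqrt2 rsqrt2 (- rsqrt2) (omega q)"
    using assms omega_lin_subst [of rsqrt2 rsqrt2 rsqrt2 "- rsqrt2" q]
    by (simp only: det covariant_def omega_const_mult)
  then have "const (- 1) * (const ((- 1) ^ b) * omega q) =
      const (- 1) * (const (- 1) * lin_subst rsqrt2 rsqrt2 rsqrt2 (- rsqrt2) (omega q))"
    by (rule arg_cong)
  then have 1: "lin_subst rsqrt2 rsqrt2 rsqrt2 (- rsqrt2) (omega q) = const ((- 1) ^ Suc b) * omega q"
    by (simp flip: *)
  have "const ((- \<i>) ^ b) * omega q = const \<i> * lin_subst 1 0 0 \<i> (omega q)"
    using assms omega_lin_subst [of 1 0 0 \<i> q] by (simp add: covariant_def omega_const_mult)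
  then have "const (- \<i>) * (const ((- \<i>) ^ b) * omega q) =
      const (- \<i>) * (const \<i> * lin_subst 1 0 0 \<i> (omega q))"
    by (rule arg_cong)
  then have 2: "lin_subst 1 0 0 \<i> (omega q) = const ((- \<i>) ^ Suc b) * omega q"
    by (simp flip: *)
  from 1 2 show ?thesis by (simp add: covariant_def)
qed

lemma bihom_copolar:
  assumes "bihom (Suc j) k q"
  shows "bihom j (Suc k) (copolar q)"
  using bihom_pd_Y [OF assms] unfolding copolar_def
  by (intro bihom.add bihom_var_mult) simp_all

lemma bihom_omega:
  assumes "bihom (Suc j) k q"
  shows "bihom j (k - 1) (omega q)"
  using bihom_pd_Y [OF assms] unfolding omega_def
  by (intro bihom_diff bihom_pd_X) simp_all

abbreviation binary_form :: "nat \<Rightarrow> complex poly \<Rightarrow> jpoly" where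
  "binary_form k Q \<equiv> bform const k Q x0 x1"

lemma bihom_binary_form:
  assumes "bihom 0 k q"
  shows "\<exists>Q. degree Q \<le> k \<and> q = binary_form k Q"
  using assms
proof (induction)
  case zero
  show ?case by (rule exI [of _ 0]) (simp add: bform_zero_poly [OF const_ring_hom])
next
  case (add p q)
  then obtain P Q where "degree P \<le> k \<and> p = binary_form k P" "degree Q \<le> k \<and> q = binary_form k Q"
    by blast
  then show ?case
    by (intro exI [of _ "P + Q"])
      (simp add: bform_add [OF const_ring_hom] degree_add_le)
next
  case (monomial a b d e c)
  then show ?case
    by (intro exI [of _ "monom c e"])
      (auto simp: bform_monom [OF const_ring_hom] mult.assoc intro: order_trans [OF degree_monom_le])
qed

lemma covariant_semi_invariant:
  assumes "degree Q \<le> k" "covariant b (binary_form k Q)"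
  shows "semi_invariant k ((- \<i>) ^ b) ((- 1) ^ b) Q"
proof -
  \<comment> \<open>Dehomogenization as a homomorphism: x0 becomes 1, x1 the indeterminate, and the
    y variables 0.\<close>
  let ?\<psi> = "psubst (\<lambda>c. [:c:]) (case_jvar (\<lambda>_. 0) (\<lambda>t. if t = 0 then 1 else [:0, 1:]))"
  have \<psi>: "comm_ring_hom ?\<psi>" by (rule psubst_hom [OF pconst_hom])
  have \<psi>c: "?\<psi> (const c) = [:c:]" for c by (rule psubst_const [OF pconst_hom])
  note \<psi>_simps = psubst_const [OF pconst_hom] psubst_var [OF pconst_hom] psubst_add [OF pconst_hom]
    psubst_mult [OF pconst_hom]
  have "?\<psi> (binary_form k Q) = bform (\<lambda>c. [:c:]) k Q 1 [:0, 1:]"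
    by (simp add: bform_hom_apply [OF \<psi>] \<psi>_simps)
  then have Q: "?\<psi> (binary_form k Q) = Q"
    using bform_dehom [OF assms(1), of 1] by simp
  have "?\<psi> (lin_subst a b c d (binary_form k Q)) = bform (\<lambda>c. [:c:]) k Q [:a, b:] [:c, d:]" for a b c d
    by (simp add: bform_hom_apply [OF \<psi>] bform_hom_apply [OF subst_hom] \<psi>_simps subst_simps)
  moreover have "?\<psi> (const c * binary_form k Q) = Polynomial.smult c Q" for c
    by (simp add: \<psi>_simps Q)
  ultimately have "bform (\<lambda>c. [:c:]) k Q [:rsqrt2, rsqrt2:] [:rsqrt2, - rsqrt2:] = Polynomial.smult ((- 1) ^ b) Q"
    "bform (\<lambda>c. [:c:]) k Q [:1, 0:] [:0, \<i>:] = Polynomial.smult ((- \<i>) ^ b) Q"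
    using assms(2) unfolding covariant_def by metis+
  then show ?thesis
    using assms(1) bform_dehom [OF assms(1), of \<i>] by (simp add: semi_invariant_def one_pCons)
qed

section \<open>Polarization-stable algebras of invariants\<close>

lemma polar_bracket: "polar bracket = 0"
  by (simp add: bracket_def mult.commute)

text \<open>Polarization replaces the x row of the determinant D by its y row, so it kills D and is
  linear over its powers.\<close>

lemma polar_bracket_power_mult: "polar (bracket ^ b * p) = bracket ^ b * polar p"
  by (simp add: polar_power polar_bracket)

section \<open>The octahedral forms in four variables and two transvectant identities\<close>

definition e8_form :: jpoly where "e8_form = x0 ^ 8 + 14 * x0 ^ 4 * x1 ^ 4 + x1 ^ 8"
definition sextic :: jpoly where "sextic = x0 * x1 * (x0 ^ 4 - x1 ^ 4)"
definition dodecic :: jpoly where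
  "dodecic = x0 ^ 12 - 33 * x0 ^ 8 * x1 ^ 4 - 33 * x0 ^ 4 * x1 ^ 8 + x1 ^ 12"

lemma binary_form_simps:
  "binary_form 8 W8 = e8_form" "binary_form 6 f6 = sextic" "binary_form 12 h12 = dodecic"
  by (simp_all add: e8_form_def sextic_def dodecic_def bform_W8 [OF const_ring_hom]
      bform_f6 [OF const_ring_hom] bform_h12 [OF const_ring_hom])

lemma polar_e8_form:
  "polar e8_form = 8 * x0 ^ 7 * y0 + 56 * x0 ^ 3 * x1 ^ 4 * y0 + 56 * x0 ^ 4 * x1 ^ 3 * y1 + 8 * x1 ^ 7 * y1"
  by (simp add: e8_form_def polar_power algebra_simps)

text \<open>With H the matrix of second derivatives of W, Euler's relations turn 8 W, 7 E W and E E
  W into values of H at (x, x) / 7, (x, y) and (y, y). The left side is then a multiple of det H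
  times D^2, and det H is a multiple of f^2.\<close>

lemma hessian_e8_form:
  "7 * (polar e8_form)\<^sup>2 - 8 * e8_form * polar (polar e8_form) = - 1344 * (bracket\<^sup>2 * sextic\<^sup>2)"
proof -
  have "polar (polar e8_form) = 56 * x0 ^ 6 * y0\<^sup>2 + 168 * x0\<^sup>2 * x1 ^ 4 * y0\<^sup>2
      + 448 * x0 ^ 3 * x1 ^ 3 * y0 * y1 + 168 * x0 ^ 4 * x1\<^sup>2 * y1\<^sup>2 + 56 * x1 ^ 6 * y1\<^sup>2"
    by (simp add: polar_e8_form polar_power power2_eq_square algebra_simps)
  moreover have "7 * (8 * a ^ 7 * u + 56 * a ^ 3 * b ^ 4 * u + 56 * a ^ 4 * b ^ 3 * v + 8 * b ^ 7 * v)\<^sup>2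
      - 8 * (a ^ 8 + 14 * a ^ 4 * b ^ 4 + b ^ 8) *
        (56 * a ^ 6 * u\<^sup>2 + 168 * a\<^sup>2 * b ^ 4 * u\<^sup>2 + 448 * a ^ 3 * b ^ 3 * u * v
         + 168 * a ^ 4 * b\<^sup>2 * v\<^sup>2 + 56 * b ^ 6 * v\<^sup>2)
      = - 1344 * ((a * v - b * u)\<^sup>2 * (a * b * (a ^ 4 - b ^ 4))\<^sup>2)" for a b u v :: jpoly
    by (simp add: algebra_simps power_numeral_reduce)
  ultimately show ?thesis
    by (simp only: polar_e8_form) (simp only: e8_form_def bracket_def sextic_def)
qed

text \<open>The coefficients 3 and 4 are half the degrees of f and W. By Euler's relations the left
  side is a multiple of D times the Jacobian of f and W, which is proportional to the
  dodecic.\<close>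

lemma jacobian_e8_form_sextic:
  "3 * sextic * polar e8_form - 4 * e8_form * polar sextic = - 4 * (bracket * dodecic)"
proof -
  have "polar sextic = 5 * x0 ^ 4 * x1 * y0 - x1 ^ 5 * y0 + x0 ^ 5 * y1 - 5 * x0 * x1 ^ 4 * y1"
    by (simp add: sextic_def polar_power power_numeral_reduce algebra_simps)
  moreover have "3 * (a * b * (a ^ 4 - b ^ 4)) *
      (8 * a ^ 7 * u + 56 * a ^ 3 * b ^ 4 * u + 56 * a ^ 4 * b ^ 3 * v + 8 * b ^ 7 * v)
      - 4 * (a ^ 8 + 14 * a ^ 4 * b ^ 4 + b ^ 8) *
        (5 * a ^ 4 * b * u - b ^ 5 * u + a ^ 5 * v - 5 * a * b ^ 4 * v)
      = - 4 * ((a * v - b * u) * (a ^ 12 - 33 * a ^ 8 * b ^ 4 - 33 * a ^ 4 * b ^ 8 + b ^ 12))"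
    for a b u v :: jpoly
    by (simp add: algebra_simps power_numeral_reduce)
  ultimately show ?thesis
    by (simp only: polar_e8_form) (simp only: e8_form_def bracket_def sextic_def dodecic_def)
qed

lemma sextic_power_form: "degree (f6 ^ n) \<le> 6 * n" "binary_form (6 * n) (f6 ^ n) = sextic ^ n"
proof -
  have "degree (f6 ^ n) \<le> 6 * n \<and> binary_form (6 * n) (f6 ^ n) = sextic ^ n"
  proof (induction n)
    case (Suc n)
    then show ?case
      using order_trans [OF degree_mult_le [of f6 "f6 ^ n"]]
        bform_mult [OF const_ring_hom, of f6 6 "f6 ^ n" "6 * n" x0 x1]
      by (auto simp: degree_f6 binary_form_simps)
  qed (simp add: bform_1 [OF const_ring_hom])
  then show "degree (f6 ^ n) \<le> 6 * n" "binary_form (6 * n) (f6 ^ n) = sextic ^ n" by auto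
qed

section \<open>Algebras stable under polarization contain all binary covariants times powers of
  D\<close>

locale subalgebra =
  fixes A :: "jpoly set"
  assumes const [intro]: "const c \<in> A"
    and add [intro]: "p \<in> A \<Longrightarrow> q \<in> A \<Longrightarrow> p + q \<in> A"
    and mult [intro]: "p \<in> A \<Longrightarrow> q \<in> A \<Longrightarrow> p * q \<in> A"
begin

lemma numeral [intro]: "numeral k \<in> A"
  using const [of "numeral k"] by (simp add: const_hom.hom_numeral)

lemma zero_mem: "0 \<in> A"
  using const [of 0] by simp

lemma sum_mem: "(\<And>i. i \<in> I \<Longrightarrow> f i \<in> A) \<Longrightarrow> sum f I \<in> A"
  by (induction I rule: infinite_finite_induct) (simp_all add: zero_mem add)

lemma diff [intro]:
  assumes "p \<in> A" "q \<in> A"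
  shows "p - q \<in> A"
proof -
  have "p + const (- 1) * q \<in> A" using assms by blast
  then show ?thesis by (simp add: const_hom.hom_uminus)
qed

lemma power [intro]: "p \<in> A \<Longrightarrow> p ^ n \<in> A"
  using const [of 1] by (induction n) auto

lemma cancel_const:
  assumes "const c * p \<in> A" "c \<noteq> 0"
  shows "p \<in> A"
proof -
  have "const (1 / c) * (const c * p) \<in> A" using assms(1) by blast
  then show ?thesis
    using assms(2) by (simp flip: mult.assoc const_hom.hom_mult)
qed

lemma cancel_neg_numeral:
  assumes "- numeral k * p \<in> A"
  shows "p \<in> A"
  by (rule cancel_const [of "- numeral k"])
    (use assms in \<open>simp_all add: const_hom.hom_uminus const_hom.hom_numeral\<close>)

lemma cancel_numeral:
  assumes "numeral k * p \<in> A"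
  shows "p \<in> A"
  by (rule cancel_const [of "numeral k"]) (use assms in \<open>simp_all add: const_hom.hom_numeral\<close>)

end

locale polar_algebra = subalgebra A for A :: "jpoly set" +
  assumes polar [intro]: "p \<in> A \<Longrightarrow> polar p \<in> A"
    and e8_form [intro]: "e8_form \<in> A"
    and sextic_power: "sextic ^ 4 \<in> A"
    and bracket_power: "bracket ^ 4 \<in> A"
begin

lemma bracket2_sextic2: "bracket\<^sup>2 * sextic\<^sup>2 \<in> A"
proof (rule cancel_neg_numeral)
  show "- 1344 * (bracket\<^sup>2 * sextic\<^sup>2) \<in> A"
    unfolding hessian_e8_form [symmetric] by blast
qed

lemma bracket3_sextic_dodecic: "bracket ^ 3 * sextic * dodecic \<in> A"
proof (rule cancel_neg_numeral)
  let ?p = "bracket\<^sup>2 * sextic\<^sup>2"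
  \<comment> \<open>The Jacobian construction with D^2 f^2 in place of f: D behaves as a constant,
    and 12 and 8 are the x-degrees of f^2 and W.\<close>
  have "12 * ?p * polar e8_form - 8 * e8_form * polar ?p =
      4 * bracket\<^sup>2 * sextic * (3 * sextic * polar e8_form - 4 * e8_form * polar sextic)"
    by (simp add: polar_bracket polar_power power2_eq_square algebra_simps)
  also have "\<dots> = - 16 * (bracket ^ 3 * sextic * dodecic)"
    unfolding jacobian_e8_form_sextic by (simp add: power_numeral_reduce algebra_simps)
  finally have eq: "12 * ?p * polar e8_form - 8 * e8_form * polar ?p = \<dots>" .
  show "- 16 * (bracket ^ 3 * sextic * dodecic) \<in> A"
    unfolding eq [symmetric] using bracket2_sextic2 by blast
qed

lemma bracket_sextic3_dodecic: "bracket * sextic ^ 3 * dodecic \<in> A"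
proof (rule cancel_neg_numeral)
  \<comment> \<open>The same construction for f^4 and W, whose degrees 24 and 8 are in the ratio 3
    to 1.\<close>
  have "3 * sextic ^ 4 * polar e8_form - e8_form * polar (sextic ^ 4) =
      sextic ^ 3 * (3 * sextic * polar e8_form - 4 * e8_form * polar sextic)"
    by (simp add: polar_power power_numeral_reduce algebra_simps)
  also have "\<dots> = - 4 * (bracket * sextic ^ 3 * dodecic)"
    unfolding jacobian_e8_form_sextic by (simp add: algebra_simps)
  finally have eq: "3 * sextic ^ 4 * polar e8_form - e8_form * polar (sextic ^ 4) = \<dots>" .
  show "- 4 * (bracket * sextic ^ 3 * dodecic) \<in> A"
    unfolding eq [symmetric] using sextic_power by blast
qed

text \<open>The multiplier \<open>t\<close> will be \<open>bracket ^ b * sextic ^ c\<close>: the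
  generator of the module need not lie in \<open>A\<close> by itself, only its product with
  \<open>t\<close>.\<close>

lemma form_module_mem:
  assumes "form_module k0 P0 k Q" "degree P0 \<le> k0" "t * binary_form k0 P0 \<in> A"
  shows "degree Q \<le> k \<and> t * binary_form k Q \<in> A"
  using assms(1)
proof induction
  case base
  show ?case using assms by simp
next
  case (zero k)
  show ?case using zero_mem by (simp add: bform_zero_poly [OF const_ring_hom])
next
  case (add k P Q)
  then show ?case
    by (auto simp: bform_add [OF const_ring_hom] distrib_left intro: degree_add_le)
next
  case (smult k Q a)
  then have "const a * (t * binary_form k Q) \<in> A" by blast
  then show ?case
    using smult order_trans [OF degree_smult_le]
    by (auto simp: bform_smult [OF const_ring_hom] mult.left_commute)
next
  case (W8 k Q)
  then have "e8_form * (t * binary_form k Q) \<in> A" by blast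
  then show ?case
    using W8 order_trans [OF degree_mult_le [of W8 Q]]
    by (auto simp: bform_mult [OF const_ring_hom] degree_W8 binary_form_simps mult.left_commute)
next
  case (f6 k Q)
  have "sextic ^ 4 * (t * binary_form k Q) \<in> A" using f6 sextic_power by blast
  then show ?case
    using f6 sextic_power_form [of 4] order_trans [OF degree_mult_le [of "f6 ^ 4" Q]]
    by (auto simp: bform_mult [OF const_ring_hom] mult.left_commute)
qed

lemma covariant_binary_form_mem:
  assumes "degree Q \<le> k" "covariant b (binary_form k Q)"
  shows "bracket ^ b * binary_form k Q \<in> A"
proof (cases "Q = 0")
  case True
  then show ?thesis using zero_mem by (simp add: bform_zero_poly [OF const_ring_hom])
next
  case False
  \<comment> \<open>Since -\<i> = \<i>^3, the multiplier of diag(1, \<i>) is \<i>^c, and f^c splits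
    off.\<close>
  define c where "c = (3 * b) mod 4"
  have i4: "\<i> ^ 4 = 1" by (simp add: power_numeral_reduce)
  have "- \<i> = \<i> ^ 3" by (simp add: power_numeral_reduce)
  then have "(- \<i>) ^ b = (\<i> ^ 3) ^ b" by (rule arg_cong)
  also have "\<dots> = \<i> ^ (4 * (3 * b div 4) + c)"
    unfolding c_def mult_div_mod_eq by (rule power_mult [symmetric])
  also have "\<dots> = \<i> ^ c" by (simp only: power_add power_mult i4 power_one mult_1)
  finally have "semi_invariant k (\<i> ^ c) ((- 1) ^ b) Q"
    using covariant_semi_invariant [OF assms] by simp
  moreover have "c < 4" by (simp add: c_def)
  ultimately
  obtain k' Q' where Q': "k = 6 * c + k'" "Q = f6 ^ c * Q'" "semi_invariant k' 1 ((- 1) ^ b) Q'"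
    using False by (rule semi_invariant_div_f6_power)
  \<comment> \<open>The parity of \<open>b\<close> is the sign under the MacWilliams matrix and
    selects the generator of the module.\<close>
  define k0 and P0 where "k0 = (if even b then 0 else 12 :: nat)" and "P0 = (if even b then 1 else h12)"
  have "form_module k0 P0 k' Q'"
    by (rule semi_invariant_form_module [OF Q'(3)]) (simp add: k0_def P0_def)
  moreover have "degree P0 \<le> k0" by (simp add: k0_def P0_def degree_h12)
  moreover have "bracket ^ b * sextic ^ c * binary_form k0 P0 \<in> A"
  proof -
    have form0: "binary_form k0 P0 = (if even b then 1 else dodecic)"
      by (simp add: k0_def P0_def binary_form_simps bform_1 [OF const_ring_hom])
    \<comment> \<open>As D^4 lies in \<open>A\<close>, only four generators matter: 1, D f^3 h, D^2
      f^2 and D^3 f h.\<close>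
    have "bracket ^ (b mod 4) * sextic ^ c * binary_form k0 P0 \<in> A"
    proof -
      have "b mod 4 < 4" by simp
      then consider "b mod 4 = 0" | "b mod 4 = 1" | "b mod 4 = 2" | "b mod 4 = 3" by linarith
      then show ?thesis
      proof cases
        case 1
        then have "c = 0" "even b" unfolding c_def by presburger+
        with 1 show ?thesis using const [of 1] form0 by simp
      next
        case 2
        then have "c = 3" "odd b" unfolding c_def by presburger+
        with 2 show ?thesis using bracket_sextic3_dodecic form0 by simp
      next
        case 3
        then have "c = 2" "even b" unfolding c_def by presburger+
        with 3 show ?thesis using bracket2_sextic2 form0 by simp
      next
        case 4
        then have "c = 1" "odd b" unfolding c_def by presburger+
        with 4 show ?thesis using bracket3_sextic_dodecic form0 by simp
      qed
    qed
    from mult [OF power [OF bracket_power, of "b div 4"] this]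
    have "(bracket ^ 4) ^ (b div 4) * bracket ^ (b mod 4) * sextic ^ c * binary_form k0 P0 \<in> A"
      by (simp only: mult.assoc)
    then show ?thesis
      by (simp only: power_mult [symmetric] power_add [symmetric] mult_div_mod_eq)
  qed
  ultimately have Q'_mem: "degree Q' \<le> k'" "bracket ^ b * sextic ^ c * binary_form k' Q' \<in> A"
    using form_module_mem by blast+
  have "binary_form k Q = sextic ^ c * binary_form k' Q'"
    unfolding Q'(1,2) sextic_power_form(2) [symmetric]
    by (rule bform_mult [OF const_ring_hom sextic_power_form(1) Q'_mem(1)])
  with Q'_mem(2) show ?thesis by (simp only: mult.assoc)
qed

theorem covariant_mem:
  assumes "bihom j k q" "covariant b q"
  shows "bracket ^ b * q \<in> A"
  using assms
proof (induction j arbitrary: b k q)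
  case 0
  then show ?case using bihom_binary_form covariant_binary_form_mem by blast
next
  case (Suc j)
  \<comment> \<open>Capelli's identity times D^b, with D^b moved inside \<open>polar\<close>. Both
    \<open>omega q\<close> and \<open>copolar q\<close> have y-degree smaller by one, so the
    induction hypothesis applies to them.\<close>
  have "bracket ^ Suc b * omega q + polar (bracket ^ b * copolar q) =
      bracket ^ b * (of_nat (Suc k * Suc j) * q)"
    unfolding capelli [OF Suc.prems(1), symmetric]
    by (simp only: polar_bracket_power_mult) (simp add: algebra_simps)
  also have "\<dots> = const (of_nat (Suc k * Suc j)) * (bracket ^ b * q)"
    by (simp only: const_hom.hom_of_nat mult.left_commute)
  finally have eq: "bracket ^ Suc b * omega q + polar (bracket ^ b * copolar q) = \<dots>" .
  have "bracket ^ Suc b * omega q \<in> A"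
    by (rule Suc.IH [OF bihom_omega [OF Suc.prems(1)] covariant_omega [OF Suc.prems(2)]])
  moreover have "bracket ^ b * copolar q \<in> A"
    by (rule Suc.IH [OF bihom_copolar [OF Suc.prems(1)] covariant_copolar [OF Suc.prems(2)]])
  ultimately have "const (of_nat (Suc k * Suc j)) * (bracket ^ b * q) \<in> A"
    unfolding eq [symmetric] by blast
  then show ?case by (rule cancel_const) (simp del: of_nat_Suc of_nat_mult)
qed

end

section \<open>Jacobi polynomials of self-dual codes\<close>

lemma UNIV_bit: "(UNIV :: bit set) = {0, 1}"
proof -
  have "a \<in> {0, 1}" for a :: bit by (cases a) simp_all
  then show ?thesis by blast
qed

lemma sum_bit: "(\<Sum>a\<in>UNIV. f a) = f (0 :: bit) + f 1"
  by (simp add: UNIV_bit)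

lemma finite_UNIV_bit: "finite (UNIV :: bit set)"
  by (simp add: UNIV_bit)

lemma bij_betw_vec: "bij_betw (vec n) (PiE {..<n} (\<lambda>_. UNIV)) (carrier_vec n :: 'a vec set)"
proof (rule bij_betw_byWitness [where f' = "\<lambda>v. restrict (\<lambda>i. v $ i) {..<n}"])
  show "\<forall>f\<in>PiE {..<n} (\<lambda>_. UNIV). restrict (\<lambda>i. vec n f $ i) {..<n} = (f :: nat \<Rightarrow> 'a)"
  proof (intro ballI ext)
    fix f :: "nat \<Rightarrow> 'a" and i assume "f \<in> PiE {..<n} (\<lambda>_. UNIV)"
    then show "restrict (\<lambda>i. vec n f $ i) {..<n} i = f i"
      by (cases "i < n") (simp_all add: PiE_def extensional_def)
  qed
  show "\<forall>v\<in>carrier_vec n. vec n (restrict (\<lambda>i. v $ i) {..<n}) = (v :: 'a vec)"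
    by (intro ballI eq_vecI) simp_all
  show "vec n ` PiE {..<n} (\<lambda>_. UNIV) \<subseteq> (carrier_vec n :: 'a vec set)"
    by (intro image_subsetI) simp
  show "(\<lambda>v. restrict (\<lambda>i. v $ i) {..<n}) ` carrier_vec n \<subseteq> PiE {..<n} (\<lambda>_. UNIV :: 'a set)"
    by (intro image_subsetI) simp
qed

lemma finite_carrier_vec_bit: "finite (carrier_vec n :: bit vec set)"
  using bij_betw_finite [OF bij_betw_vec [where 'a = bit, of n]] finite_UNIV_bit
  by (simp add: finite_PiE)

lemma sum_carrier_vec_prod:
  "(\<Sum>v\<in>carrier_vec n. \<Prod>i<n. g i (v $ i)) = (\<Prod>i<n. g i (0 :: bit) + g i 1 :: 'a::comm_ring_1)"
proof -
  have "(\<Sum>v\<in>carrier_vec n. \<Prod>i<n. g i (v $ i)) =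
      (\<Sum>f\<in>PiE {..<n} (\<lambda>_. UNIV). \<Prod>i<n. g i (vec n f $ i))"
    by (rule sum.reindex_bij_betw [OF bij_betw_vec, symmetric])
  also have "\<dots> = (\<Sum>f\<in>PiE {..<n} (\<lambda>_. UNIV). \<Prod>i<n. g i (f i))"
    by (intro sum.cong prod.cong) auto
  also have "\<dots> = (\<Prod>i<n. \<Sum>a\<in>UNIV. g i a)"
    by (rule prod_sum_PiE [symmetric]) (simp_all add: finite_UNIV_bit)
  finally show ?thesis by (simp add: sum_bit)
qed

text \<open>The nontrivial additive character of the field of two elements.\<close>

definition bit_sign :: "bit \<Rightarrow> complex" where "bit_sign a = (if a = 0 then 1 else - 1)"

lemma bit_sign_simps [simp]: "bit_sign 0 = 1" "bit_sign 1 = - 1"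
  by (simp_all add: bit_sign_def)

lemma bit_sign_add: "bit_sign (a + b) = bit_sign a * bit_sign b"
  by (cases a; cases b) (simp_all add: bit_sign_def)

lemma bit_sign_sum: "finite A \<Longrightarrow> bit_sign (sum f A) = (\<Prod>x\<in>A. bit_sign (f x))"
proof (induction A rule: finite_induct)
  case (insert x F)
  show ?case
    by (simp only: sum.insert [OF insert(1,2)] prod.insert [OF insert(1,2)] bit_sign_add insert.IH)
qed simp

section \<open>Jacobi polynomials coordinate by coordinate, and their polarization\<close>

definition coord_var :: "nat set \<Rightarrow> nat \<Rightarrow> bit \<Rightarrow> jvar" where
  "coord_var T i a = (if i \<in> T then Y a else X a)"

text \<open>A product over coordinates instead of powers with counts, so that substitutions and
  derivations act factor by factor.\<close>

definition word_monomial :: "nat \<Rightarrow> nat set \<Rightarrow> bit vec \<Rightarrow> jpoly" where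
  "word_monomial n T u = (\<Prod>i<n. var (coord_var T i (u $ i)))"

lemma prod_coord_count:
  fixes g :: "bit \<Rightarrow> 'a::comm_monoid_mult"
  assumes "finite S"
  shows "(\<Prod>i\<in>S. g (u $ i)) = g 0 ^ coord_count S 0 u * g 1 ^ coord_count S 1 u"
proof -
  have "(\<Prod>i\<in>S. g (u $ i)) = (\<Prod>i\<in>S. if u $ i = 0 then g 0 else g 1)"
    by (intro prod.cong) auto
  also have "\<dots> = g 0 ^ card (S \<inter> {i. u $ i = 0}) * g 1 ^ card (S \<inter> - {i. u $ i = 0})"
    using assms by (simp add: prod.If_cases)
  also have "S \<inter> {i. u $ i = 0} = {i \<in> S. u $ i = 0}" by blast
  also have "S \<inter> - {i. u $ i = 0} = {i \<in> S. u $ i = 1}" by auto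
  finally show ?thesis by (simp add: coord_count_def)
qed

lemma word_monomial_eq:
  assumes "T \<subseteq> {..<n}"
  shows "word_monomial n T u = y0 ^ coord_count T 0 u * y1 ^ coord_count T 1 u *
    (x0 ^ coord_count ({..<n} - T) 0 u * x1 ^ coord_count ({..<n} - T) 1 u)"
proof -
  have fin: "finite T" using assms finite_subset by blast
  have "{..<n} = T \<union> ({..<n} - T)" using assms by blast
  then have "word_monomial n T u =
      (\<Prod>i\<in>T. var (coord_var T i (u $ i))) * (\<Prod>i\<in>{..<n} - T. var (coord_var T i (u $ i)))"
    unfolding word_monomial_def using fin
    by (subst \<open>{..<n} = T \<union> ({..<n} - T)\<close>, intro prod.union_disjoint) auto
  also have "(\<Prod>i\<in>T. var (coord_var T i (u $ i))) = (\<Prod>i\<in>T. var (Y (u $ i)))"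
    by (intro prod.cong) (simp_all add: coord_var_def)
  also have "(\<Prod>i\<in>{..<n} - T. var (coord_var T i (u $ i))) = (\<Prod>i\<in>{..<n} - T. var (X (u $ i)))"
    by (intro prod.cong) (simp_all add: coord_var_def)
  finally show ?thesis
    using prod_coord_count [of T "\<lambda>a. var (Y a)" u] prod_coord_count [of "{..<n} - T" "\<lambda>a. var (X a)" u] fin
    by simp
qed

lemma jacobi_poly_eq:
  assumes "T \<subseteq> {..<n}"
  shows "jacobi_poly n C T = (\<Sum>u\<in>C. word_monomial n T u)"
  by (simp add: jacobi_poly_def word_monomial_eq [OF assms] mult.assoc)

lemma coord_count_add:
  assumes "finite S"
  shows "coord_count S 0 u + coord_count S 1 u = card S"
proof -
  have "S = {i \<in> S. u $ i = 0} \<union> {i \<in> S. u $ i = 1}" by auto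
  then show ?thesis unfolding coord_count_def using assms
    by (subst card_Un_disjoint [symmetric]) auto
qed

lemma bihom_sum: "(\<And>u. u \<in> C \<Longrightarrow> bihom j k (f u)) \<Longrightarrow> bihom j k (sum f C)"
  by (induction C rule: infinite_finite_induct) (auto intro: bihom.zero bihom.add)

lemma bihom_jacobi_poly:
  assumes "T \<subseteq> {..<n}"
  shows "bihom (card T) (n - card T) (jacobi_poly n C T)"
proof -
  have fin: "finite T" using assms finite_subset by blast
  have "bihom (card T) (n - card T) (word_monomial n T u)" for u
  proof -
    have "coord_count ({..<n} - T) 0 u + coord_count ({..<n} - T) 1 u = n - card T"
      using coord_count_add [of "{..<n} - T" u] fin assms by (simp add: card_Diff_subset)
    then show ?thesis unfolding word_monomial_eq [OF assms]
      using bihom.monomial [OF coord_count_add [OF fin, of u], where c = 1] by fastforce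
  qed
  then show ?thesis unfolding jacobi_poly_eq [OF assms] by (intro bihom_sum)
qed

lemma homogeneous_add:
  assumes "homogeneous d p" "homogeneous d q"
  shows "homogeneous d (p + q)"
  using assms Poly_Mapping.keys_add [of p q] by (auto simp: homogeneous_def)

lemma bihom_homogeneous:
  assumes "bihom j k p"
  shows "homogeneous (j + k) p"
  using assms
proof induction
  case (monomial a b d e c)
  define m where "m = Poly_Mapping.single (Y 0) a + Poly_Mapping.single (Y 1) b
    + (Poly_Mapping.single (X 0) d + Poly_Mapping.single (X 1) e)"
  have lk: "Poly_Mapping.lookup m (Y 0) = a" "Poly_Mapping.lookup m (Y 1) = b"
    "Poly_Mapping.lookup m (X 0) = d" "Poly_Mapping.lookup m (X 1) = e"
    by (simp_all add: m_def lookup_add lookup_single when_def)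
  have "(\<Sum>v\<in>Poly_Mapping.keys m. Poly_Mapping.lookup m v) = (\<Sum>v\<in>UNIV. Poly_Mapping.lookup m v)"
  proof (intro sum.mono_neutral_left)
    show "finite (UNIV :: jvar set)" by (simp add: UNIV_jvar)
  qed (simp_all add: in_keys_iff)
  also have "\<dots> = j + k" using monomial by (simp add: UNIV_jvar lk)
  finally have "homogeneous (j + k) (Poly_Mapping.single m c)"
    by (auto simp: homogeneous_def split: if_splits)
  then show ?case by (simp add: single_eq_monom_at monom_at_def lk)
next
  case zero
  show ?case by (simp add: homogeneous_def)
next
  case (add p q)
  then show ?case by (intro homogeneous_add)
qed

lemma homogeneous_jacobi_poly:
  assumes "T \<subseteq> {..<n}"
  shows "homogeneous n (jacobi_poly n C T)"
proof -
  have "card T \<le> n" using card_mono [OF _ assms] by simp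
  then show ?thesis using bihom_homogeneous [OF bihom_jacobi_poly [OF assms, of C]] by simp
qed

text \<open>By the Leibniz rule, one coordinate outside \<open>T\<close> at a time has its x
  variable replaced by the corresponding y variable, which moves it into \<open>T\<close>; factors
  from \<open>T\<close> are killed.\<close>

lemma polar_jacobi_poly:
  assumes "T \<subseteq> {..<n}"
  shows "polar (jacobi_poly n C T) = (\<Sum>i\<in>{..<n} - T. jacobi_poly n C (insert i T))"
proof -
  have "polar (word_monomial n T u) = (\<Sum>i\<in>{..<n} - T. word_monomial n (insert i T) u)" for u
  proof -
    have "polar (word_monomial n T u) = (\<Sum>i<n. polar (var (coord_var T i (u $ i))) *
        (\<Prod>j\<in>{..<n} - {i}. var (coord_var T j (u $ j))))"
      unfolding word_monomial_def polar_def by (rule derivation_prod) simp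
    also have "\<dots> = (\<Sum>i\<in>{..<n} - T. polar (var (coord_var T i (u $ i))) *
        (\<Prod>j\<in>{..<n} - {i}. var (coord_var T j (u $ j))))"
      by (intro sum.mono_neutral_right) (auto simp: coord_var_def)
    also have "\<dots> = (\<Sum>i\<in>{..<n} - T. word_monomial n (insert i T) u)"
    proof (rule sum.cong)
      fix i assume i: "i \<in> {..<n} - T"
      have "(\<Prod>j\<in>{..<n} - {i}. var (coord_var T j (u $ j))) =
          (\<Prod>j\<in>{..<n} - {i}. var (coord_var (insert i T) j (u $ j)))"
        by (intro prod.cong) (auto simp: coord_var_def)
      then show "polar (var (coord_var T i (u $ i))) * (\<Prod>j\<in>{..<n} - {i}. var (coord_var T j (u $ j))) =
          word_monomial n (insert i T) u"
        unfolding word_monomial_def using i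
        by (subst prod.remove [of "{..<n}" i]) (auto simp: coord_var_def)
    qed simp
    finally show ?thesis .
  qed
  then have "polar (jacobi_poly n C T) = (\<Sum>u\<in>C. \<Sum>i\<in>{..<n} - T. word_monomial n (insert i T) u)"
    by (simp add: jacobi_poly_eq [OF assms] polar_def derivation_sum)
  also have "\<dots> = (\<Sum>i\<in>{..<n} - T. \<Sum>u\<in>C. word_monomial n (insert i T) u)"
    by (rule sum.swap)
  also have "\<dots> = (\<Sum>i\<in>{..<n} - T. jacobi_poly n C (insert i T))"
    using assms by (intro sum.cong) (simp_all add: jacobi_poly_eq)
  finally show ?thesis .
qed

section \<open>Invariance of the Jacobi polynomials of self-dual codes\<close>

context
  fixes n :: nat and C :: "bit vec set"
  assumes C: "C = dual_code n C"
begin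

lemma self_dual_carrier: "C \<subseteq> carrier_vec n"
  using C by (auto simp: dual_code_def)

lemma self_dual_finite: "finite C"
  using self_dual_carrier finite_carrier_vec_bit finite_subset by blast

lemma self_dual_zero: "0\<^sub>v n \<in> C"
  using self_dual_carrier by (subst C) (auto simp: dual_code_def)

lemma self_dual_add:
  assumes "u \<in> C" "v \<in> C"
  shows "u + v \<in> C"
proof -
  have "u \<in> dual_code n C" "v \<in> dual_code n C" using assms C by auto
  then have "u + v \<in> dual_code n C"
    using self_dual_carrier by (auto simp: dual_code_def scalar_prod_add_distrib)
  then show ?thesis using C by simp
qed

text \<open>Orthogonality of characters: for \<open>v\<close> outside \<open>C\<close> some
  \<open>w\<close> in \<open>C\<close> has inner product 1 with it, and translation by
  \<open>w\<close> permutes \<open>C\<close> while reversing every sign.\<close>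

lemma sum_sign_self_dual:
  assumes "v \<in> carrier_vec n"
  shows "(\<Sum>u\<in>C. bit_sign (u \<bullet> v)) = (if v \<in> C then of_nat (card C) else 0)"
proof (cases "v \<in> C")
  case True
  then have "v \<in> dual_code n C" by (subst C [symmetric])
  then have "u \<bullet> v = 0" if "u \<in> C" for u
    using that by (simp add: dual_code_def)
  then show ?thesis using True by simp
next
  case False
  then have "v \<notin> dual_code n C" by (subst C [symmetric])
  then obtain w where w: "w \<in> C" "w \<bullet> v = 1"
    using assms by (auto simp: dual_code_def)
  have wn: "w \<in> carrier_vec n" using w(1) self_dual_carrier by blast
  have inv: "w + (w + u) = u" if "u \<in> C" for u
  proof (rule eq_vecI)
    have "u \<in> carrier_vec n" using that self_dual_carrier by blast
    moreover have "a + (a + b) = b" for a b :: bit by (cases a; cases b) simp_all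
    ultimately show "dim_vec (w + (w + u)) = dim_vec u"
      "\<And>i. i < dim_vec u \<Longrightarrow> (w + (w + u)) $ i = u $ i"
      using wn by simp_all
  qed
  have "bij_betw ((+) w) C C"
    by (rule bij_betw_byWitness [where f' = "(+) w"]) (auto simp: inv self_dual_add w(1))
  then have "(\<Sum>u\<in>C. bit_sign (u \<bullet> v)) = (\<Sum>u\<in>C. bit_sign ((w + u) \<bullet> v))"
    by (rule sum.reindex_bij_betw [symmetric])
  also have "\<dots> = (\<Sum>u\<in>C. - bit_sign (u \<bullet> v))"
  proof (rule sum.cong)
    fix u assume "u \<in> C"
    then have "(w + u) \<bullet> v = w \<bullet> v + u \<bullet> v"
      using wn assms self_dual_carrier by (intro add_scalar_prod_distrib) auto
    then show "bit_sign ((w + u) \<bullet> v) = - bit_sign (u \<bullet> v)" by (simp add: bit_sign_add w(2))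
  qed simp
  finally show ?thesis using False by (simp add: sum_negf)
qed

text \<open>The product of transformed variables expands into a sum over all words \<open>v\<close>.
  After exchanging the sums, the inner character sum selects the words \<open>v\<close> in
  \<open>C\<close>.\<close>

lemma macwilliams:
  assumes T: "T \<subseteq> {..<n}"
  shows "lin_subst rsqrt2 rsqrt2 rsqrt2 (- rsqrt2) (jacobi_poly n C T) =
    const (rsqrt2 ^ n * of_nat (card C)) * jacobi_poly n C T"
proof -
  let ?M = "lin_subst rsqrt2 rsqrt2 rsqrt2 (- rsqrt2)"
  let ?g = "\<lambda>u i a. const (rsqrt2 * bit_sign (u $ i * a)) * var (coord_var T i a)"
  interpret M: comm_ring_hom ?M by (rule subst_hom)
  have var: "?M (var (coord_var T i (u $ i))) = ?g u i 0 + ?g u i 1" for u i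
    by (cases "u $ i") (simp_all add: coord_var_def subst_simps)
  have scalar: "(\<Prod>i<n. bit_sign (u $ i * v $ i)) = bit_sign (u \<bullet> v)" if "v \<in> carrier_vec n" for u v
  proof -
    have "u \<bullet> v = (\<Sum>i<n. u $ i * v $ i)"
      using that by (simp only: scalar_prod_def carrier_vecD atLeast0LessThan)
    then show ?thesis by (simp only: bit_sign_sum finite_lessThan)
  qed
  have prod: "(\<Prod>i<n. ?g u i (v $ i)) = const (rsqrt2 ^ n * bit_sign (u \<bullet> v)) * word_monomial n T v"
    if "v \<in> carrier_vec n" for u v
    by (simp only: word_monomial_def prod.distrib const_hom.hom_prod [symmetric] prod_constant
        card_lessThan scalar [OF that])
  have "?M (jacobi_poly n C T) = (\<Sum>u\<in>C. \<Prod>i<n. ?g u i 0 + ?g u i 1)"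
    by (simp add: jacobi_poly_eq [OF T] word_monomial_def M.hom_sum M.hom_prod var)
  also have "\<dots> = (\<Sum>u\<in>C. \<Sum>v\<in>carrier_vec n. \<Prod>i<n. ?g u i (v $ i))"
    by (simp only: sum_carrier_vec_prod [of "?g _"])
  also have "\<dots> = (\<Sum>u\<in>C. \<Sum>v\<in>carrier_vec n.
      const (rsqrt2 ^ n * bit_sign (u \<bullet> v)) * word_monomial n T v)"
    by (intro sum.cong refl prod)
  also have "\<dots> = (\<Sum>v\<in>carrier_vec n. \<Sum>u\<in>C.
      const (rsqrt2 ^ n * bit_sign (u \<bullet> v)) * word_monomial n T v)"
    by (rule sum.swap)
  also have "\<dots> = (\<Sum>v\<in>carrier_vec n.
      const (rsqrt2 ^ n * (\<Sum>u\<in>C. bit_sign (u \<bullet> v))) * word_monomial n T v)"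
    by (simp only: sum_distrib_left const_hom.hom_sum sum_distrib_right)
  also have "\<dots> = (\<Sum>v\<in>carrier_vec n.
      if v \<in> C then const (rsqrt2 ^ n * of_nat (card C)) * word_monomial n T v else 0)"
    by (intro sum.cong refl) (simp add: sum_sign_self_dual)
  also have "\<dots> = (\<Sum>v\<in>C. const (rsqrt2 ^ n * of_nat (card C)) * word_monomial n T v)"
    using self_dual_carrier by (simp add: finite_carrier_vec_bit sum.If_cases Int_absorb1)
  finally show ?thesis by (simp add: jacobi_poly_eq [OF T] sum_distrib_left)
qed

text \<open>Applying the MacWilliams transformation twice determines the size of a self-dual code.\<close>

lemma card_self_dual: "rsqrt2 ^ n * of_nat (card C) = 1"
proof -
  let ?M = "lin_subst rsqrt2 rsqrt2 rsqrt2 (- rsqrt2)"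
  let ?J = "jacobi_poly n C {}"
  let ?c = "rsqrt2 ^ n * of_nat (card C)"
  interpret ev: comm_ring_hom "psubst (\<lambda>c. c) (\<lambda>_. 1 :: complex)" by (rule psubst_hom [OF ident_hom])
  have half: "const rsqrt2 * (const rsqrt2 * p) = const (1 / 2) * p" for p
    by (simp add: rsqrt2_sq flip: mult.assoc const_hom.hom_mult)
  have two: "2 * const (1 / 2) = 1"
    using const_hom.hom_mult [of 2 "1 / 2"] by (simp add: const_hom.hom_numeral)
  interpret M: comm_ring_hom ?M by (rule subst_hom)
  have "?M (?M p) = p" for p
  proof (induction p rule: jpoly_induct)
    case (var v)
    have "\<forall>v. ?M (?M (var v)) = var v"
      by (simp add: all_jvar subst_simps M.hom_minus const_hom.hom_uminus algebra_simps half two)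
    then show ?case by blast
  qed (simp_all add: subst_simps)
  then have "?J = ?M (?M ?J)" by simp
  also have "\<dots> = const (?c * ?c) * ?J"
    by (simp add: macwilliams subst_simps const_hom.hom_mult mult.assoc)
  \<comment> \<open>Setting all variables to 1 turns the polynomial into the nonzero number of
    codewords, which can be cancelled.\<close>
  finally have "psubst (\<lambda>c. c) (\<lambda>_. 1) ?J = psubst (\<lambda>c. c) (\<lambda>_. 1) (const (?c * ?c) * ?J)"
    by (rule arg_cong)
  moreover have "psubst (\<lambda>c. c) (\<lambda>_. 1) ?J = of_nat (card C)"
    by (simp add: jacobi_poly_eq word_monomial_def ev.hom_sum ev.hom_prod psubst_var [OF ident_hom])
  moreover have "card C \<noteq> 0" using self_dual_finite self_dual_zero by auto
  ultimately have cc: "?c * ?c = 1"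
    by (simp add: ev.hom_mult psubst_const [OF ident_hom])
  define r where "r = (1 / sqrt 2) ^ n * real (card C)"
  have r: "?c = complex_of_real r" by (simp add: r_def rsqrt2_def)
  have "r \<ge> 0" by (simp add: r_def)
  moreover have "r * r = 1" using cc unfolding r by (metis of_real_eq_1_iff of_real_mult)
  \<comment> \<open>The scalar is real and nonnegative, which rules out -1.\<close>
  ultimately have "r = 1" using square_eq_1_iff [of r] by auto
  then show ?thesis using r by simp
qed

text \<open>The substitution diag(1, \<i>) multiplies the monomial of a word by \<i> to its weight,
  and all weights are divisible by 4.\<close>

lemma covariant_jacobi_poly:
  assumes "\<forall>u\<in>C. 4 dvd weight u" and T: "T \<subseteq> {..<n}"
  shows "covariant 0 (jacobi_poly n C T)"
proof -
  let ?S = "lin_subst 1 0 0 \<i>"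
  interpret S: comm_ring_hom ?S by (rule subst_hom)
  have var: "?S (var (coord_var T i a)) = const (if a = 0 then 1 else \<i>) * var (coord_var T i a)" for i a
    by (simp add: coord_var_def subst_simps)
  have "?S (word_monomial n T u) = word_monomial n T u" if "u \<in> C" for u
  proof -
    have u: "u \<in> carrier_vec n" using that self_dual_carrier by blast
    have "(\<Prod>i<n. if u $ i = 0 then 1 else \<i>) = \<i> ^ weight u"
    proof -
      have "{..<n} \<inter> - {i. u $ i = 0} = {i. i < dim_vec u \<and> u $ i \<noteq> 0}"
        using u by auto
      then show ?thesis by (simp only: prod.If_cases finite_lessThan prod.neutral_const
            prod_constant weight_def mult_1)
    qed
    moreover have "\<i> ^ weight u = 1"
    proof -
      obtain k where "weight u = 4 * k" using assms(1) \<open>u \<in> C\<close> by blast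
      moreover have "\<i> ^ 4 = 1" by (simp add: power_numeral_reduce)
      ultimately show ?thesis by (simp only: power_mult power_one)
    qed
    ultimately show ?thesis
      by (simp only: word_monomial_def S.hom_prod var prod.distrib const_hom.hom_prod [symmetric])
        simp
  qed
  then have "?S (jacobi_poly n C T) = jacobi_poly n C T"
    by (simp add: jacobi_poly_eq [OF T] S.hom_sum)
  then show ?thesis by (simp add: covariant_def macwilliams [OF T] card_self_dual)
qed

end

section \<open>The codes \<open>d\<^sub>2\<^sub>m\<^sup>+\<close> and the main theorem\<close>

lemma sum_lessThan_add: "(\<Sum>j<m + k. f j) = (\<Sum>j<m. f j) + (\<Sum>i<k. f (m + i :: nat))"
  for f :: "nat \<Rightarrow> 'a::comm_monoid_add"
  by (induction k) (simp_all add: add.assoc)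

lemma prod_lessThan_add: "(\<Prod>j<m + k. f j) = (\<Prod>j<m. f j) * (\<Prod>i<k. f (m + i :: nat))"
  for f :: "nat \<Rightarrow> 'a::comm_monoid_mult"
  by (induction k) (simp_all add: mult.assoc)

lemma of_nat_bit_eq_0: "(of_nat n :: bit) = 0 \<longleftrightarrow> even n"
proof (cases "even n")
  case True
  then obtain k where "n = 2 * k" by blast
  then show ?thesis by simp
next
  case False
  then obtain k where "n = 2 * k + 1" by (rule oddE)
  then show ?thesis by simp
qed

lemma linear_code_self_dual:
  assumes "C = dual_code n C"
  shows "linear_code n C"
proof -
  have "c \<cdot>\<^sub>v u \<in> C" if "u \<in> C" for c u
  proof (cases c)
    case zero
    have "c \<cdot>\<^sub>v u = 0\<^sub>v n"
      using that self_dual_carrier [OF assms] zero by (intro eq_vecI) auto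
    then show ?thesis using self_dual_zero [OF assms] by simp
  next
    case one
    then show ?thesis using that by simp
  qed
  then have "submodule class_ring C (module_vec TYPE(bit) n)"
    using self_dual_carrier [OF assms] self_dual_add [OF assms] self_dual_zero [OF assms]
    by (intro LinearCombinations.submodule.intro vec_module) (simp_all add: module_vec_simps)
  then show ?thesis
    unfolding linear_code_def by (intro VectorSpace.subspace.intro vec_vs)
qed

text \<open>The code \<open>d\<^sub>2\<^sub>m\<^sup>+\<close>, where the two coordinates of a pair are numbered \<open>i\<close> and \<open>m + i\<close>.\<close>

definition dplus :: "nat \<Rightarrow> bit vec set" where
  "dplus m = {u \<in> carrier_vec (m + m). (\<exists>e. \<forall>i<m. u $ (m + i) = u $ i + e) \<and> (\<Sum>i<m. u $ i) = 0}"

text \<open>The half word \<open>a\<close> is repeated, complemented in the second half when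
  \<open>e\<close> is 1.\<close>

definition dplus_word :: "nat \<Rightarrow> bit \<Rightarrow> bit vec \<Rightarrow> bit vec" where
  "dplus_word m e a = vec (m + m) (\<lambda>j. if j < m then a $ j else a $ (j - m) + e)"

lemma dplus_word_simps [simp]:
  "dim_vec (dplus_word m e a) = m + m"
  "i < m \<Longrightarrow> dplus_word m e a $ i = a $ i"
  "i < m \<Longrightarrow> dplus_word m e a $ (m + i) = a $ i + e"
  by (simp_all add: dplus_word_def)

lemma dplus_word_mem:
  assumes "(\<Sum>i<m. a $ i) = 0"
  shows "dplus_word m e a \<in> dplus m"
proof -
  have "(\<Sum>i<m. dplus_word m e a $ i) = (\<Sum>i<m. a $ i)"
    by (intro sum.cong refl) simp
  with assms have "(\<Sum>i<m. dplus_word m e a $ i) = 0" by metis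
  moreover have "\<exists>e'. \<forall>i<m. dplus_word m e a $ (m + i) = dplus_word m e a $ i + e'"
    by (intro exI [of _ e] allI impI) (simp only: dplus_word_simps)
  moreover have "dplus_word m e a \<in> carrier_vec (m + m)"
    by (intro carrier_vecI dplus_word_simps)
  ultimately show ?thesis unfolding dplus_def by blast
qed

lemma scalar_prod_halves:
  assumes "v \<in> carrier_vec (m + m)"
  shows "u \<bullet> v = (\<Sum>i<m. u $ i * v $ i + u $ (m + i) * v $ (m + i))"
  using assms by (simp only: scalar_prod_def carrier_vecD atLeast0LessThan sum_lessThan_add sum.distrib)

text \<open>In each pair the quadratic terms cancel; the linear terms vanish because the first
  halves have even weight, the constant ones because \<open>m\<close> is even.\<close>

lemma dplus_orthogonal:
  assumes "even m" "u \<in> dplus m" "v \<in> dplus m"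
  shows "u \<bullet> v = 0"
proof -
  obtain e where e: "\<And>i. i < m \<Longrightarrow> u $ (m + i) = u $ i + e" and u: "(\<Sum>i<m. u $ i) = 0"
    using assms(2) by (auto simp: dplus_def)
  obtain f where f: "\<And>i. i < m \<Longrightarrow> v $ (m + i) = v $ i + f" and v: "(\<Sum>i<m. v $ i) = 0"
    and vc: "v \<in> carrier_vec (m + m)"
    using assms(3) by (auto simp: dplus_def)
  have mz: "(of_nat m :: bit) = 0" using assms(1) by (simp only: of_nat_bit_eq_0)
  have bits: "a * b + (a + e) * (b + f) = a * f + e * b + e * f" for a b :: bit
    by (cases a; cases b; cases e; cases f) simp_all
  have "u \<bullet> v = (\<Sum>i<m. u $ i * f + e * v $ i + e * f)"
    unfolding scalar_prod_halves [OF vc] by (intro sum.cong refl) (simp only: lessThan_iff e f bits)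
  also have "\<dots> = (\<Sum>i<m. u $ i) * f + e * (\<Sum>i<m. v $ i) + of_nat m * (e * f)"
    by (simp only: sum.distrib sum_distrib_left sum_distrib_right sum_constant card_lessThan)
  also have "\<dots> = 0"
    unfolding u v mz by (simp only: mult_zero_left mult_zero_right add_0)
  finally show ?thesis .
qed

lemma dual_dplus_subset:
  assumes "even m" "m > 0" "v \<in> dual_code (m + m) (dplus m)"
  shows "v \<in> dplus m"
proof -
  have vc: "v \<in> carrier_vec (m + m)" using assms(3) by (simp add: dual_code_def)
  have orth: "(\<Sum>i<m. a $ i * v $ i + (a $ i + e) * v $ (m + i)) = 0"
    if "(\<Sum>i<m. a $ i) = 0" for a e
  proof -
    have "dplus_word m e a \<bullet> v = 0"
      using assms(3) dplus_word_mem [OF that, of e] by (simp add: dual_code_def)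
    also have "dplus_word m e a \<bullet> v = (\<Sum>i<m. a $ i * v $ i + (a $ i + e) * v $ (m + i))"
      unfolding scalar_prod_halves [OF vc] by (intro sum.cong refl) (simp only: lessThan_iff dplus_word_simps)
    finally show ?thesis by simp
  qed
  define e where "e = v $ 0 + v $ m"
  have pair: "v $ (m + i) = v $ i + e" if i: "i < m" for i
  proof -
    \<comment> \<open>Testing against the repeated word of weight two at 0 and \<open>i\<close>
      shows that pairs 0 and \<open>i\<close> have the same sum. Adding two indicators gives the
      zero word when \<open>i\<close> is 0.\<close>
    define a where "a = vec m (\<lambda>l. (if l = 0 then 1 else 0) + (if l = i then 1 else 0 :: bit))"
    have a: "a $ l = (if l = 0 then 1 else 0) + (if l = i then 1 else 0)" if "l < m" for l
      using that by (simp only: a_def index_vec)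
    have s: "(\<Sum>l<m. a $ l * c l) = c 0 + c i" for c
    proof -
      have "(\<Sum>l<m. a $ l * c l) = (\<Sum>l<m. (if l = 0 then c l else 0) + (if l = i then c l else 0))"
        by (intro sum.cong refl) (simp add: a distrib_right)
      also have "\<dots> = c 0 + c i"
        using i assms(2) by (simp only: sum.distrib sum.delta finite_lessThan lessThan_iff if_True)
      finally show ?thesis .
    qed
    have "(\<Sum>l<m. a $ l) = (\<Sum>l<m. a $ l * 1)" by (simp only: mult_1_right)
    also have "\<dots> = 1 + 1" by (rule s)
    finally have "(\<Sum>l<m. a $ l) = 0" by simp
    from orth [OF this, of 0]
    have "(\<Sum>l<m. a $ l * (v $ l + v $ (m + l))) = 0"
      by (simp only: distrib_left add_0_right)
    then have "(v $ 0 + v $ (m + 0)) + (v $ i + v $ (m + i)) = 0" by (simp only: s)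
    moreover have "q = p + (x + y)" if "(x + y) + (p + q) = 0" for x y p q :: bit
      using that by (cases x; cases y; cases p; cases q) simp_all
    ultimately show ?thesis unfolding e_def by simp
  qed
  \<comment> \<open>The second test word is zero on the first half and one on the second; it yields
    the parity condition.\<close>
  have "(\<Sum>i<m. 0\<^sub>v m $ i) = (0 :: bit)" by (intro sum.neutral) simp
  from orth [OF this, of 1]
  have "0 = (\<Sum>i<m. 0\<^sub>v m $ i * v $ i + (0\<^sub>v m $ i + 1) * v $ (m + i))" by (rule sym)
  also have "\<dots> = (\<Sum>i<m. v $ (m + i))" by (intro sum.cong refl) simp
  also have "(\<Sum>i<m. v $ (m + i)) = (\<Sum>i<m. v $ i + e)"
    by (intro sum.cong refl) (simp only: lessThan_iff pair)
  also have "\<dots> = (\<Sum>i<m. v $ i) + of_nat m * e"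
    by (simp only: sum.distrib sum_constant card_lessThan)
  also have "\<dots> = (\<Sum>i<m. v $ i)"
    using of_nat_bit_eq_0 [of m] assms(1) by (metis add_0_right mult_zero_left)
  finally have "(\<Sum>i<m. v $ i) = 0" by (rule sym)
  with pair vc show ?thesis by (auto simp: dplus_def)
qed

lemma dplus_self_dual:
  assumes "even m" "m > 0"
  shows "dplus m = dual_code (m + m) (dplus m)"
proof
  show "dplus m \<subseteq> dual_code (m + m) (dplus m)"
  proof -
    have "dplus m \<subseteq> carrier_vec (m + m)" unfolding dplus_def by blast
    then show ?thesis using dplus_orthogonal [OF assms(1)] unfolding dual_code_def by blast
  qed
  show "dual_code (m + m) (dplus m) \<subseteq> dplus m"
    using dual_dplus_subset [OF assms] by blast
qed

text \<open>A repeated word has twice an even weight; a complemented one has exactly one 1 in each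
  of the \<open>m\<close> pairs.\<close>

lemma weight_dplus:
  assumes "4 dvd m" "u \<in> dplus m"
  shows "4 dvd weight u"
proof -
  obtain e where e: "\<And>i. i < m \<Longrightarrow> u $ (m + i) = u $ i + e" and u: "(\<Sum>i<m. u $ i) = 0"
    and dim: "dim_vec u = m + m"
    using assms(2) by (auto simp: dplus_def)
  let ?w = "\<lambda>a :: bit. if a = 0 then 0 else 1 :: nat"
  have "weight u = (\<Sum>j<m + m. ?w (u $ j))"
    unfolding weight_def dim by (subst card_eq_sum, intro sum.mono_neutral_cong_left) auto
  also have "\<dots> = (\<Sum>i<m. ?w (u $ i) + ?w (u $ i + e))"
    unfolding sum_lessThan_add sum.distrib
    by (intro arg_cong2 [where f = "(+)"] sum.cong refl) (simp only: lessThan_iff e)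
  finally have w: "weight u = (\<Sum>i<m. ?w (u $ i) + ?w (u $ i + e))" .
  show ?thesis
  proof (cases e)
    case zero
    have "of_nat (\<Sum>i<m. ?w (u $ i)) = (\<Sum>i<m. u $ i)"
      unfolding of_nat_sum by (intro sum.cong refl) auto
    then have "even (\<Sum>i<m. ?w (u $ i))" using u of_nat_bit_eq_0 by metis
    moreover have "weight u = 2 * (\<Sum>i<m. ?w (u $ i))"
      unfolding w sum_distrib_left by (intro sum.cong refl) (simp add: zero)
    ultimately show ?thesis by (auto elim!: evenE)
  next
    case one
    have "?w a + ?w (a + 1) = 1" for a by (cases a) simp_all
    then have "weight u = m" unfolding w one by simp
    then show ?thesis using assms(1) by simp
  qed
qed

lemma type_II_dplus:
  assumes "4 dvd m" "m > 0"
  shows "type_II (m + m) (dplus m)"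
proof -
  have "even m" using assms(1) dvd_trans [of 2 4 m] by simp
  then show ?thesis
    using dplus_self_dual [OF _ assms(2)] linear_code_self_dual weight_dplus [OF assms(1)]
    by (auto simp: type_II_def)
qed

text \<open>The bit \<open>e\<close> is recovered as the sum of pair 0, which exists because
  \<open>m\<close> is positive.\<close>

lemma bij_betw_dplus_word:
  assumes "m > 0"
  shows "bij_betw (\<lambda>(e, a). dplus_word m e a) (UNIV \<times> {a \<in> carrier_vec m. (\<Sum>i<m. a $ i) = 0}) (dplus m)"
proof (rule bij_betw_byWitness [where f' = "\<lambda>u. (u $ m + u $ 0, vec m (\<lambda>i. u $ i))"], safe)
  fix e :: bit and a :: "bit vec" assume "a \<in> carrier_vec m"
  have *: "c + e + c = e" for c :: bit by (cases c; cases e) simp_all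
  show "dplus_word m e a $ m + dplus_word m e a $ 0 = e"
    using dplus_word_simps(3) [of 0 m e a] assms by (simp only: dplus_word_simps add_0_right *)
  show "vec m (\<lambda>i. dplus_word m e a $ i) = a"
    using \<open>a \<in> carrier_vec m\<close> by (intro eq_vecI) simp_all
next
  fix u assume "u \<in> dplus m"
  then obtain e where e: "\<And>i. i < m \<Longrightarrow> u $ (m + i) = u $ i + e" and u: "(\<Sum>i<m. u $ i) = 0"
    and dim: "dim_vec u = m + m"
    by (auto simp: dplus_def)
  have "u $ 0 + e + u $ 0 = e" by (cases "u $ 0"; cases e) simp_all
  then have e': "u $ m + u $ 0 = e" using e [OF assms] by simp
  have "u $ j = u $ (j - m) + e" if "j < m + m" "\<not> j < m" for j
    using e [of "j - m"] that by simp
  then show "dplus_word m (u $ m + u $ 0) (vec m (\<lambda>i. u $ i)) = u"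
    unfolding e' using dim by (intro eq_vecI) (auto simp: dplus_word_def)
  have "(\<Sum>i<m. vec m (\<lambda>i. u $ i) $ i) = (\<Sum>i<m. u $ i)"
    by (intro sum.cong refl) simp
  then show "(\<Sum>i<m. vec m (\<lambda>i. u $ i) $ i) = 0" using u by (rule trans)
qed (auto simp: dplus_word_mem)

text \<open>Adding the sum twisted by the character \<open>bit_sign\<close> doubles the even words
  and removes the odd ones. The factor 2 avoids division here and in the formulas below.\<close>

lemma sum_even_words:
  fixes g :: "nat \<Rightarrow> bit \<Rightarrow> jpoly"
  shows "2 * (\<Sum>a\<in>{a \<in> carrier_vec m. (\<Sum>i<m. a $ i) = 0}. \<Prod>i<m. g i (a $ i)) =
    (\<Prod>i<m. g i 0 + g i 1) + (\<Prod>i<m. g i 0 - g i 1)"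
proof -
  let ?F = "\<lambda>a. \<Prod>i<m. g i (a $ i)"
  have neg: "(\<Prod>i<m. g i 0 - g i 1) = (\<Sum>a\<in>carrier_vec m. const (bit_sign (\<Sum>i<m. a $ i)) * ?F a)"
  proof -
    have "(\<Prod>i<m. g i 0 - g i 1) = (\<Prod>i<m. const (bit_sign 0) * g i 0 + const (bit_sign 1) * g i 1)"
      by (simp add: const_hom.hom_uminus)
    also have "\<dots> = (\<Sum>a\<in>carrier_vec m. \<Prod>i<m. const (bit_sign (a $ i)) * g i (a $ i))"
      by (rule sum_carrier_vec_prod [symmetric])
    also have "\<dots> = (\<Sum>a\<in>carrier_vec m. const (bit_sign (\<Sum>i<m. a $ i)) * ?F a)"
      by (intro sum.cong refl)
        (simp only: prod.distrib bit_sign_sum finite_lessThan const_hom.hom_prod)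
    finally show ?thesis .
  qed
  have "(\<Prod>i<m. g i 0 + g i 1) + (\<Prod>i<m. g i 0 - g i 1) =
      (\<Sum>a\<in>carrier_vec m. ?F a + const (bit_sign (\<Sum>i<m. a $ i)) * ?F a)"
    by (simp only: neg sum.distrib sum_carrier_vec_prod [of g])
  also have "\<dots> = (\<Sum>a\<in>carrier_vec m. if (\<Sum>i<m. a $ i) = 0 then 2 * ?F a else 0)"
    by (intro sum.cong refl) (simp add: bit_sign_def const_hom.hom_uminus)
  also have "\<dots> = (\<Sum>a\<in>{a \<in> carrier_vec m. (\<Sum>i<m. a $ i) = 0}. 2 * ?F a)"
    by (simp only: sum.inter_filter finite_carrier_vec_bit)
  finally show ?thesis by (simp only: sum_distrib_left)
qed

lemma jacobi_poly_dplus: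
  assumes "m > 0" "T \<subseteq> {..<m + m}"
  defines "g \<equiv> \<lambda>e i a. var (coord_var T i a) * var (coord_var T (m + i) (a + e))"
  shows "2 * jacobi_poly (m + m) (dplus m) T =
    (\<Prod>i<m. g 0 i 0 + g 0 i 1) + (\<Prod>i<m. g 0 i 0 - g 0 i 1) +
    ((\<Prod>i<m. g 1 i 0 + g 1 i 1) + (\<Prod>i<m. g 1 i 0 - g 1 i 1))"
proof -
  let ?E = "{a \<in> carrier_vec m. (\<Sum>i<m. a $ i) = 0} :: bit vec set"
  have word: "word_monomial (m + m) T (dplus_word m e a) = (\<Prod>i<m. g e i (a $ i))" for e a
    unfolding word_monomial_def prod_lessThan_add prod.distrib [symmetric] g_def
    by (intro prod.cong refl) (simp only: lessThan_iff dplus_word_simps)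
  have "jacobi_poly (m + m) (dplus m) T = (\<Sum>(e, a)\<in>UNIV \<times> ?E. word_monomial (m + m) T (dplus_word m e a))"
    unfolding jacobi_poly_eq [OF assms(2)]
    by (subst sum.reindex_bij_betw [OF bij_betw_dplus_word [OF assms(1)], symmetric])
      (simp only: case_prod_unfold)
  also have "\<dots> = (\<Sum>e\<in>UNIV. \<Sum>a\<in>?E. \<Prod>i<m. g e i (a $ i))"
    by (simp only: word sum.cartesian_product)
  finally show ?thesis
    by (simp only: sum_bit distrib_left sum_even_words)
qed

section \<open>W, f^4 and D^4 from the codes of length 8 and 24\<close>

lemma bracket_power_expansion:
  "(y0 * x0 + y1 * x1) ^ 4 + (y0 * x0 - y1 * x1) ^ 4 + ((y0 * x1 + y1 * x0) ^ 4 + (y0 * x1 - y1 * x0) ^ 4)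
    - ((y0\<^sup>2 + y1\<^sup>2) * (y0 * x0 + y1 * x1)\<^sup>2 * (x0\<^sup>2 + x1\<^sup>2)
      + (y0\<^sup>2 - y1\<^sup>2) * (y0 * x0 - y1 * x1)\<^sup>2 * (x0\<^sup>2 - x1\<^sup>2)
      + 4 * y0 * y1 * x0 * x1 * (y0 * x1 + y1 * x0)\<^sup>2) = 2 * bracket ^ 4"
  unfolding bracket_def by (simp add: algebra_simps power_numeral_reduce)

text \<open>W^3 and the weight enumerator of \<open>dplus 12\<close> agree in the coefficient of
  x0^24, so their difference, an invariant of degree 24 divisible by f, is a multiple of
  f^4.\<close>

lemma sextic_power_expansion:
  "2 * e8_form ^ 3 - ((x0\<^sup>2 + x1\<^sup>2) ^ 12 + (x0\<^sup>2 - x1\<^sup>2) ^ 12 + (2 * x0 * x1) ^ 12) = - 48 * sextic ^ 4"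
proof -
  have "2 * (a ^ 8 + 14 * a ^ 4 * b ^ 4 + b ^ 8) ^ 3 -
      ((a\<^sup>2 + b\<^sup>2) ^ 12 + (a\<^sup>2 - b\<^sup>2) ^ 12 + (2 * a * b) ^ 12) =
      - 48 * (a * b * (a ^ 4 - b ^ 4)) ^ 4" for a b :: jpoly
    by (simp add: algebra_simps power_numeral_reduce)
  then show ?thesis unfolding e8_form_def sextic_def .
qed

text \<open>Of the four products, the one with complemented pairs and minus signs has all factors x0
  x1 - x1 x0 = 0, and \<open>m\<close> is positive.\<close>

lemma jacobi_poly_dplus_empty:
  assumes "m > 0"
  shows "2 * jacobi_poly (m + m) (dplus m) {} =
    (x0\<^sup>2 + x1\<^sup>2) ^ m + (x0\<^sup>2 - x1\<^sup>2) ^ m + (2 * x0 * x1) ^ m"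
  unfolding jacobi_poly_dplus [OF assms empty_subsetI]
  using assms by (simp add: coord_var_def power2_eq_square power_0_left mult_ac flip: mult_2)

lemma e8_form_eq: "2 * e8_form = 2 * jacobi_poly (4 + 4) (dplus 4) {}"
  unfolding jacobi_poly_dplus_empty [OF zero_less_numeral] e8_form_def
  by (simp add: algebra_simps power_numeral_reduce)

lemma prod_lessThan_4: "(\<Prod>i<4. f i) = f 0 * f 1 * f 2 * f 3" for f :: "nat \<Rightarrow> 'a::comm_monoid_mult"
  by (simp add: numeral_eq_Suc)

text \<open>In the extended Hamming code \<open>dplus 4\<close> the set \<open>{0, 1, 2, 3}\<close> supports a codeword,
  whereas \<open>{0, 1, 2, 4}\<close> does not.\<close>

lemma bracket_power_eq:
  "2 * bracket ^ 4 = 2 * jacobi_poly (4 + 4) (dplus 4) {0, 1, 2, 3} - 2 * jacobi_poly (4 + 4) (dplus 4) {0, 1, 2, 4}"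
proof -
  have 1: "2 * jacobi_poly (4 + 4) (dplus 4) {0, 1, 2, 3} =
      (y0 * x0 + y1 * x1) ^ 4 + (y0 * x0 - y1 * x1) ^ 4 + ((y0 * x1 + y1 * x0) ^ 4 + (y0 * x1 - y1 * x0) ^ 4)"
    by (subst jacobi_poly_dplus) (auto simp: prod_lessThan_4 coord_var_def power_numeral_reduce mult.assoc)
  \<comment> \<open>Here pair (0, 4) lies in the set, pairs (1, 5) and (2, 6) are split, and pair
    (3, 7) lies outside. The fourth product vanishes because of the unsplit pairs.\<close>
  have 2: "2 * jacobi_poly (4 + 4) (dplus 4) {0, 1, 2, 4} =
      (y0\<^sup>2 + y1\<^sup>2) * (y0 * x0 + y1 * x1)\<^sup>2 * (x0\<^sup>2 + x1\<^sup>2)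
      + (y0\<^sup>2 - y1\<^sup>2) * (y0 * x0 - y1 * x1)\<^sup>2 * (x0\<^sup>2 - x1\<^sup>2)
      + 4 * y0 * y1 * x0 * x1 * (y0 * x1 + y1 * x0)\<^sup>2"
    by (subst jacobi_poly_dplus)
      (auto simp: prod_lessThan_4 coord_var_def power2_eq_square algebra_simps)
  show ?thesis unfolding 1 2 by (rule bracket_power_expansion [symmetric])
qed

section \<open>Generation in degrees 8 and 24\<close>

interpretation generated: subalgebra "alg_generated S" for S
  by unfold_locales (auto intro: alg_generated.intros)

lemma alg_generated_least: "S \<subseteq> alg_generated T \<Longrightarrow> alg_generated S \<subseteq> alg_generated T"
proof
  fix p assume "S \<subseteq> alg_generated T" "p \<in> alg_generated S"
  from this(2,1) show "p \<in> alg_generated T"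
    by induction (auto intro: alg_generated.intros)
qed

definition generators :: "jpoly set" where
  "generators = {jacobi_poly n C T | n C T. type_II n C \<and> T \<subseteq> {..<n} \<and> n \<in> {8, 24}}"

lemma generators_mem:
  assumes "m = 4 \<or> m = 12" "T \<subseteq> {..<m + m}"
  shows "jacobi_poly (m + m) (dplus m) T \<in> alg_generated generators"
proof (rule alg_generated.gen)
  have "type_II (m + m) (dplus m)" "m + m \<in> {8, 24}"
    using assms(1) type_II_dplus [of 4] type_II_dplus [of 12] by auto
  then show "jacobi_poly (m + m) (dplus m) T \<in> generators"
    unfolding generators_def using assms(2) by blast
qed

text \<open>Polarization changes only the set \<open>T\<close> of a generator, not the code or its
  length; the Leibniz rule covers products.\<close>

lemma polar_generators:
  assumes "p \<in> alg_generated generators"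
  shows "polar p \<in> alg_generated generators"
  using assms
proof induction
  case (gen p)
  then obtain n C T where p: "p = jacobi_poly n C T" "type_II n C" "T \<subseteq> {..<n}" "n \<in> {8, 24}"
    unfolding generators_def by blast
  have "jacobi_poly n C (insert i T) \<in> alg_generated generators" if "i \<in> {..<n} - T" for i
  proof (rule alg_generated.gen)
    have "insert i T \<subseteq> {..<n}" using p(3) that by blast
    then show "jacobi_poly n C (insert i T) \<in> generators"
      unfolding generators_def using p(2,4) by blast
  qed
  then show ?case unfolding p(1) polar_jacobi_poly [OF p(3)] by (rule generated.sum_mem)
next
  case (const c)
  show ?case unfolding polar_simps by (rule generated.zero_mem)
next
  case (add p q)
  then show ?case unfolding polar_simps by (intro alg_generated.add)
next
  case (mult p q)
  then show ?case unfolding polar_simps by (intro alg_generated.add alg_generated.mult)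
qed

interpretation generators: polar_algebra "alg_generated generators"
proof
  let ?A = "alg_generated generators"
  have numeral: "numeral k \<in> ?A" for k by (rule generated.numeral)
  show "polar p \<in> ?A" if "p \<in> ?A" for p using that by (rule polar_generators)
  show e8: "e8_form \<in> ?A"
  proof (rule generated.cancel_numeral)
    show "2 * e8_form \<in> ?A" unfolding e8_form_eq
      by (intro alg_generated.mult numeral generators_mem) simp_all
  qed
  show "sextic ^ 4 \<in> ?A"
  proof (rule generated.cancel_neg_numeral)
    have "2 * e8_form ^ 3 - 2 * jacobi_poly (12 + 12) (dplus 12) {} \<in> ?A"
      by (intro generated.diff alg_generated.mult generated.power numeral e8 generators_mem) simp_all
    then show "- 48 * sextic ^ 4 \<in> ?A"
      unfolding jacobi_poly_dplus_empty [OF zero_less_numeral] sextic_power_expansion .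
  qed
  show "bracket ^ 4 \<in> ?A"
  proof (rule generated.cancel_numeral)
    show "2 * bracket ^ 4 \<in> ?A" unfolding bracket_power_eq
      by (intro generated.diff alg_generated.mult numeral generators_mem) auto
  qed
qed

lemma jacobi_poly_mem:
  assumes "type_II n C" "T \<subseteq> {..<n}"
  shows "jacobi_poly n C T \<in> alg_generated generators"
proof -
  have C: "C = dual_code n C" "\<forall>u\<in>C. 4 dvd weight u" using assms(1) by (simp_all add: type_II_def)
  \<comment> \<open>Jacobi polynomials are true invariants, the case of exponent 0 of the membership
    theorem.\<close>
  have "bracket ^ 0 * jacobi_poly n C T \<in> alg_generated generators"
    by (rule generators.covariant_mem [OF bihom_jacobi_poly [OF assms(2)]
          covariant_jacobi_poly [OF C assms(2)]])
  then show ?thesis by simp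
qed

lemma jacobi_ring_eq: "jacobi_ring = alg_generated (jacobi_part 8 \<union> jacobi_part 24)"
proof
  have "generators \<subseteq> jacobi_part 8 \<union> jacobi_part 24"
  proof
    fix p assume "p \<in> generators"
    then obtain n C T where p: "p = jacobi_poly n C T" "type_II n C" "T \<subseteq> {..<n}" "n \<in> {8, 24}"
      unfolding generators_def by blast
    then have "p \<in> jacobi_ring"
      unfolding jacobi_ring_def by (intro alg_generated.gen) blast
    then have "p \<in> jacobi_part n"
      using p(1) homogeneous_jacobi_poly [OF p(3)] by (simp add: jacobi_part_def)
    then show "p \<in> jacobi_part 8 \<union> jacobi_part 24" using p(4) by blast
  qed
  then have "alg_generated generators \<subseteq> alg_generated (jacobi_part 8 \<union> jacobi_part 24)"
    by (intro alg_generated_least) (blast intro: alg_generated.gen)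
  moreover have "jacobi_ring \<subseteq> alg_generated generators"
    unfolding jacobi_ring_def by (intro alg_generated_least) (use jacobi_poly_mem in blast)
  ultimately show "jacobi_ring \<subseteq> alg_generated (jacobi_part 8 \<union> jacobi_part 24)" by blast
  show "alg_generated (jacobi_part 8 \<union> jacobi_part 24) \<subseteq> jacobi_ring"
    unfolding jacobi_ring_def
    by (intro alg_generated_least) (auto simp: jacobi_part_def jacobi_ring_def)
qed

lemma span_subset_alg_generated: "Modules.module.span poly_scale B \<subseteq> alg_generated B"
proof
  interpret vector_space poly_scale by (rule vector_space_poly_scale)
  fix p assume "p \<in> span B"
  then show "p \<in> alg_generated B"
  proof (induction rule: span_induct_alt)
    case base
    show ?case using alg_generated.const [of 0] by simp
  next
    case (step c p q)
    then show ?case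
      unfolding poly_scale_def by (blast intro: alg_generated.intros)
  qed
qed

lemma subset_span: "B \<subseteq> Modules.module.span poly_scale B"
proof -
  interpret vector_space poly_scale by (rule vector_space_poly_scale)
  show ?thesis using span_superset .
qed

theorem theorem6p1:
  shows "jacobi_ring = alg_generated (jacobi_part 8 \<union> jacobi_part 24) \<and>
    (\<forall>B8 B24. is_basis B8 (jacobi_part 8) \<and> is_basis B24 (jacobi_part 24) \<longrightarrow>
       jacobi_ring = alg_generated (B8 \<union> B24))"
proof (intro conjI allI impI)
  show eq: "jacobi_ring = alg_generated (jacobi_part 8 \<union> jacobi_part 24)" by (rule jacobi_ring_eq)
  fix B8 B24 assume "is_basis B8 (jacobi_part 8) \<and> is_basis B24 (jacobi_part 24)"
  then have span: "Modules.module.span poly_scale B8 = jacobi_part 8"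
    "Modules.module.span poly_scale B24 = jacobi_part 24"
    by (simp_all add: is_basis_def)
  \<comment> \<open>Spans lie in generated algebras, so bases generate the two homogeneous parts;
    conversely they are contained in these parts.\<close>
  have mono: "alg_generated B \<subseteq> alg_generated (B8 \<union> B24)" if "B \<subseteq> B8 \<union> B24" for B
    using that by (intro alg_generated_least) (blast intro: alg_generated.gen)
  have "jacobi_part 8 \<union> jacobi_part 24 \<subseteq> alg_generated (B8 \<union> B24)"
    using span_subset_alg_generated [of B8] span_subset_alg_generated [of B24] mono [of B8] mono [of B24] span
    by blast
  moreover have "B8 \<union> B24 \<subseteq> jacobi_part 8 \<union> jacobi_part 24"
    using subset_span [of B8] subset_span [of B24] span by blast
  ultimately show "jacobi_ring = alg_generated (B8 \<union> B24)"
    unfolding eq by (intro equalityI alg_generated_least) (auto intro: alg_generated.gen)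
qed

end
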